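(* Assume (A1), (A2), (A3). Then, as $\sigma_0\to0$, the law of $(\tilde\mu^{\sigma_0}_t)_{t\in[0,T]}$ on $C([0,T];\mathbb{R})$ converges weakly to $$\tfrac12\delta_{(k_t)_{t\in[0,T]}}+\tfrac12\delta_{(-k_t)_{t\in[0,T]}}.$$
   Context: Fix $T>0$, $\kappa\in\mathbb{R}$, $\delta\in(0,T)$. Let $\eta$ solve $\eta_t'=\eta_t^2-2\kappa\eta_t-1$, $\eta_T=1$ on $[0,T]$; set $w_t=\exp(\int_t^T(\eta_s-\kappa)ds)$, $r_t=\int_t^Tw_s^{-2}ds$, $k_t=\int_0^tw_s^{-2}ds$. The function $\theta:[0,T]\times\mathbb{R}\to\mathbb{R}$ is defined by $\theta(t,x)=-\mathrm{sign}(x)$ if $t\le\delta$; $\theta(t,x)=-\mathrm{sign}(x)$ if $t\ge\delta$ and $|x|\ge r_\delta-r_t$; $\theta(t,x)=-x/(r_\delta-r_t)$ if $t>\delta$ and $|x|<r_\delta-r_t$. A curve $\psi\in C([0,T];\mathbb{R})$ is admissible if it is non-negative, non-decreasing, and there is $a<\delta$ with $\psi_t>(r_\delta-r_t)_+$ for all $t\in(a,T]$. For each $\sigma_0\in(0,1)$ let $\tilde\theta^{\sigma_0}:[0,T]\times\mathbb{R}\to[-1,1]$ be continuous. (A1) There is $L:(0,\infty)\to(0,\infty)$ with $L(\sigma_0)\to+\infty$ and $L(\sigma_0)|\ln\sigma_0|^{-1/8}\to0$ as $\sigma_0\to0$, such that for every admissible $\psi$, $\lim_{\sigma_0\to0}\sup_{t\in[0,T],|x|\ge\sigma_0^2L(\sigma_0)+\psi_t}|\tilde\theta^{\sigma_0}(t,x)-\theta(t,x)|=0$.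 (A2) For each $\sigma_0$, on a filtered probability space carrying a Brownian motion $B$, there are continuous real-valued adapted processes $\tilde\mu^{\sigma_0},\tilde Y^{\sigma_0},\Delta^{\sigma_0}$, with $\tilde Y^{\sigma_0}$ valued in $[-1,1]$, such that $\tilde\mu^{\sigma_0}_t=-\int_0^tw_s^{-2}\tilde Y^{\sigma_0}_sds+\sigma_0\int_0^tw_s^{-1}dB_s$ and $\tilde Y^{\sigma_0}_t=\tilde\theta^{\sigma_0}(t,\tilde\mu^{\sigma_0}_t)-\Delta^{\sigma_0}_t$ for $t\in[0,T]$, and $\sup_{t\in[0,T]}|\Delta^{\sigma_0}_t|\to0$ in probability as $\sigma_0\to0$. (A3) For each $\sigma_0$, the law of $\tilde\mu^{\sigma_0}$ on $C([0,T];\mathbb{R})$ equals the law of $-\tilde\mu^{\sigma_0}$. *)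

theory Defs
  imports "HOL-Probability.Probability"
begin

text \<open>w, r, k built from the Riccati solution eta (given as a parameter).\<close>

definition wfun :: "real \<Rightarrow> real \<Rightarrow> (real \<Rightarrow> real) \<Rightarrow> real \<Rightarrow> real" where
  "wfun T \<kappa> \<eta> t = exp (integral {t..T} (\<lambda>s. \<eta> s - \<kappa>))"

definition rfun :: "real \<Rightarrow> real \<Rightarrow> (real \<Rightarrow> real) \<Rightarrow> real \<Rightarrow> real" where
  "rfun T \<kappa> \<eta> t = integral {t..T} (\<lambda>s. 1 / (wfun T \<kappa> \<eta> s)\<^sup>2)"

definition kfun :: "real \<Rightarrow> real \<Rightarrow> (real \<Rightarrow> real) \<Rightarrow> real \<Rightarrow> real" where
  "kfun T \<kappa> \<eta> t = integral {0..t} (\<lambda>s. 1 / (wfun T \<kappa> \<eta> s)\<^sup>2)"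

text \<open>The limiting feedback theta (sign(0) read as sgn 0 = 0).\<close>

definition theta :: "real \<Rightarrow> real \<Rightarrow> (real \<Rightarrow> real) \<Rightarrow> real \<Rightarrow> real \<Rightarrow> real \<Rightarrow> real" where
  "theta T \<kappa> \<eta> \<delta> t x =
     (if t \<le> \<delta> \<or> \<bar>x\<bar> \<ge> rfun T \<kappa> \<eta> \<delta> - rfun T \<kappa> \<eta> t then - sgn x
      else - x / (rfun T \<kappa> \<eta> \<delta> - rfun T \<kappa> \<eta> t))"

definition admissible :: "real \<Rightarrow> real \<Rightarrow> (real \<Rightarrow> real) \<Rightarrow> real \<Rightarrow> (real \<Rightarrow> real) \<Rightarrow> bool" where
  "admissible T \<kappa> \<eta> \<delta> \<psi> \<longleftrightarrow>
     continuous_on {0..T} \<psi> \<and>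
     (\<forall>t\<in>{0..T}. 0 \<le> \<psi> t) \<and>
     (\<forall>s\<in>{0..T}. \<forall>t\<in>{0..T}. s \<le> t \<longrightarrow> \<psi> s \<le> \<psi> t) \<and>
     (\<exists>a < \<delta>. \<forall>t\<in>{0..T}. a < t \<longrightarrow> \<psi> t > max 0 (rfun T \<kappa> \<eta> \<delta> - rfun T \<kappa> \<eta> t))"

definition filtration_on :: "real \<Rightarrow> 'a measure \<Rightarrow> (real \<Rightarrow> 'a measure) \<Rightarrow> bool" where
  "filtration_on T M F \<longleftrightarrow>
     (\<forall>t\<in>{0..T}. subalgebra M (F t)) \<and>
     (\<forall>s\<in>{0..T}. \<forall>t\<in>{0..T}. s \<le> t \<longrightarrow> sets (F s) \<subseteq> sets (F t))"

definition adapted_on :: "real \<Rightarrow> (real \<Rightarrow> 'a measure) \<Rightarrow> (real \<Rightarrow> 'a \<Rightarrow> real) \<Rightarrow> bool" where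
  "adapted_on T F X \<longleftrightarrow> (\<forall>t\<in>{0..T}. X t \<in> borel_measurable (F t))"

definition continuous_process :: "real \<Rightarrow> 'a measure \<Rightarrow> (real \<Rightarrow> 'a \<Rightarrow> real) \<Rightarrow> bool" where
  "continuous_process T M X \<longleftrightarrow> (\<forall>\<omega>\<in>space M. continuous_on {0..T} (\<lambda>t. X t \<omega>))"

definition brownian_motion :: "real \<Rightarrow> 'a measure \<Rightarrow> (real \<Rightarrow> 'a measure) \<Rightarrow> (real \<Rightarrow> 'a \<Rightarrow> real) \<Rightarrow> bool" where
  "brownian_motion T M F B \<longleftrightarrow>
     prob_space M \<and> filtration_on T M F \<and> adapted_on T F B \<and> continuous_process T M B \<and>
     (\<forall>\<omega>\<in>space M. B 0 \<omega> = 0) \<and>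
     (\<forall>s\<in>{0..T}. \<forall>t\<in>{0..T}. s < t \<longrightarrow>
        distributed M lborel (\<lambda>\<omega>. B t \<omega> - B s \<omega>)
          (\<lambda>x. ennreal (normal_density 0 (sqrt (t - s)) x)) \<and>
        (\<forall>A\<in>sets (F s). \<forall>S\<in>sets borel.
           measure M (A \<inter> {\<omega>\<in>space M. B t \<omega> - B s \<omega> \<in> S})
             = measure M A * measure M {\<omega>\<in>space M. B t \<omega> - B s \<omega> \<in> S}))"

text \<open>Wiener integral of a deterministic C^1 integrand g against B, pathwise via
  integration by parts: int_0^t g dB = g t * B t - int_0^t B_s g'(s) ds  (B_0 = 0).\<close>

definition wiener_int :: "(real \<Rightarrow> real) \<Rightarrow> (real \<Rightarrow> 'a \<Rightarrow> real) \<Rightarrow> real \<Rightarrow> 'a \<Rightarrow> real" where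
  "wiener_int g B t \<omega> = g t * B t \<omega> - integral {0..t} (\<lambda>s. B s \<omega> * deriv g s)"

definition sup_dist :: "real \<Rightarrow> (real \<Rightarrow> real) \<Rightarrow> (real \<Rightarrow> real) \<Rightarrow> real" where
  "sup_dist T f g = (SUP t\<in>{0..T}. \<bar>f t - g t\<bar>)"

definition bcont_functional :: "real \<Rightarrow> ((real \<Rightarrow> real) \<Rightarrow> real) \<Rightarrow> bool" where
  "bcont_functional T \<Phi> \<longleftrightarrow>
     (\<exists>C. \<forall>f. continuous_on {0..T} f \<longrightarrow> \<bar>\<Phi> f\<bar> \<le> C) \<and>
     (\<forall>f. continuous_on {0..T} f \<longrightarrow> (\<forall>\<epsilon>>0. \<exists>d>0. \<forall>g. continuous_on {0..T} g \<longrightarrow>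
          sup_dist T f g < d \<longrightarrow> \<bar>\<Phi> g - \<Phi> f\<bar> < \<epsilon>))"

end

theory Submission
  imports Defs "HOL-Real_Asymp.Real_Asymp"
begin

text \<open>
  By the symmetry (A3), the expectation of \<open>\<Phi>(\<mu>)\<close> is half the expectation of
  \<open>\<Phi>(\<mu>) + \<Phi>(-\<mu>)\<close>, so it suffices that with probability tending to 1 the path \<open>\<mu>\<close> is
  uniformly close to one of \<open>k\<close> and \<open>-k\<close>. Put \<open>b = \<sigma>\<^sup>2 L(\<sigma>)\<close> and \<open>\<psi>(t) = max 0 (k(t) - k(\<delta>/2))\<close>,
  an admissible curve; where \<open>\<bar>x\<bar> \<ge> b + \<psi>(t)\<close> the drift is asymptotically \<open>sgn x\<close> times the
  derivative of \<open>k\<close>. Nothing is known about the drift near zero, but over a time step \<open>b\<close> it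
  moves the path by \<open>O(b)\<close> only, while the noise moves it by \<open>\<sigma> sqrt b\<close> times a Gaussian. A Gaussian
  of size \<open>O(sqrt L)\<close> thus throws the path out of \<open>[-3b, 3b]\<close>; since \<open>L\<close> grows slowly, such an
  increment occurs among the first \<open>1/\<sigma>\<close> steps, that is, within a time of order \<open>\<sigma> L(\<sigma>)\<close>. From
  the first grid time \<open>\<tau>\<close> outside on, an exponential martingale bound gives
  \<open>\<sigma>\<bar>B(t) - B(\<tau>)\<bar> \<le> C b + c (t - \<tau>)\<close> for all \<open>t \<ge> \<tau>\<close> with a slope \<open>c\<close> below the speed of the drift,
  up to a probability \<open>O(exp (- c' L))\<close>. The bound is applied on each event \<open>{\<tau> = i b}\<close>, which lies
  in the sigma-algebra of time \<open>i b\<close>. So the path never returns to the barrier \<open>b + \<psi>\<close>,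
  and therefore follows \<open>k\<close> or \<open>-k\<close>.
\<close>

section \<open>Exponential maximal inequality for Brownian increments\<close>

text \<open>Completing the square: exponential tilting shifts the mean of a Gaussian and keeps its
  variance.\<close>

lemma exp_normal_density:
  assumes "0 < \<sigma>"
  shows "exp (l * x) * normal_density 0 \<sigma> x = exp (l\<^sup>2 * \<sigma>\<^sup>2 / 2) * normal_density (l * \<sigma>\<^sup>2) \<sigma> x"
proof -
  have "l * x + - (x - 0)\<^sup>2 / (2 * \<sigma>\<^sup>2) = l\<^sup>2 * \<sigma>\<^sup>2 / 2 + - (x - l * \<sigma>\<^sup>2)\<^sup>2 / (2 * \<sigma>\<^sup>2)"
    using assms by (simp add: field_simps power2_eq_square)
  then show ?thesis
    unfolding normal_density_def by (simp flip: exp_add)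
qed

lemma nn_integral_exp_normal:
  assumes "0 < \<sigma>"
  shows "(\<integral>\<^sup>+x. ennreal (normal_density 0 \<sigma> x) * ennreal (exp (l * x)) \<partial>lborel) = ennreal (exp (l\<^sup>2 * \<sigma>\<^sup>2 / 2))"
proof -
  interpret prob_space "density lborel (normal_density (l * \<sigma>\<^sup>2) \<sigma>)"
    using assms by (rule prob_space_normal_density)
  have "(\<integral>\<^sup>+x. ennreal (normal_density 0 \<sigma> x) * ennreal (exp (l * x)) \<partial>lborel)
      = (\<integral>\<^sup>+x. ennreal (exp (l\<^sup>2 * \<sigma>\<^sup>2 / 2)) * ennreal (normal_density (l * \<sigma>\<^sup>2) \<sigma> x) \<partial>lborel)"
    using exp_normal_density[OF assms, of l]
    by (intro nn_integral_cong) (simp flip: ennreal_mult add: mult.commute)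
  also have "\<dots> = ennreal (exp (l\<^sup>2 * \<sigma>\<^sup>2 / 2)) * (\<integral>\<^sup>+x. ennreal (normal_density (l * \<sigma>\<^sup>2) \<sigma> x) \<partial>lborel)"
    by (rule nn_integral_cmult) simp
  also have "(\<integral>\<^sup>+x. ennreal (normal_density (l * \<sigma>\<^sup>2) \<sigma> x) \<partial>lborel) = 1"
    using emeasure_space_1 by (simp add: emeasure_density)
  finally show ?thesis by simp
qed

text \<open>Hypothesis \<open>A\<close> says that the measure with density \<open>h\<close> and the
  measure \<open>M\<close> scaled by \<open>K\<close> agree on \<open>F\<close>, and the integral of
  an \<open>F\<close>-measurable function sees a measure only through its restriction to
  \<open>F\<close>. This plays the part of a constant conditional expectation of \<open>h\<close>;
  nonnegative integrals avoid integrability questions.\<close>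

lemma nn_integral_mult_subalgebra:
  assumes sub: "subalgebra M F"
    and Z: "Z \<in> borel_measurable F"
    and h: "h \<in> borel_measurable M"
    and A: "\<And>A. A \<in> sets F \<Longrightarrow> (\<integral>\<^sup>+\<omega>. indicator A \<omega> * h \<omega> \<partial>M) = K * emeasure M A"
  shows "(\<integral>\<^sup>+\<omega>. Z \<omega> * h \<omega> \<partial>M) = K * (\<integral>\<^sup>+\<omega>. Z \<omega> \<partial>M)"
proof -
  have sub': "subalgebra (density M h) F"
    using sub by (simp add: subalgebra_def)
  have ZM [measurable]: "Z \<in> borel_measurable M"
    using measurable_from_subalg[OF sub Z] .
  note h [measurable]
  have Zr: "Z \<in> borel_measurable (restr_to_subalg M F)"
    using measurable_in_subalg[OF sub Z] .
  have eq: "restr_to_subalg (density M h) F = scale_measure K (restr_to_subalg M F)"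
  proof (rule measure_eqI)
    show "sets (restr_to_subalg (density M h) F) = sets (scale_measure K (restr_to_subalg M F))"
      using sets_restr_to_subalg[OF sub] sets_restr_to_subalg[OF sub'] by simp
    fix A assume "A \<in> sets (restr_to_subalg (density M h) F)"
    then have AF: "A \<in> sets F" using sets_restr_to_subalg[OF sub'] by simp
    then have AM: "A \<in> sets M" using sub by (auto simp: subalgebra_def)
    show "emeasure (restr_to_subalg (density M h) F) A = emeasure (scale_measure K (restr_to_subalg M F)) A"
      using A[OF AF] AM
      by (simp add: emeasure_restr_to_subalg[OF sub AF] emeasure_restr_to_subalg[OF sub' AF]
          emeasure_density mult.commute)
  qed
  have "(\<integral>\<^sup>+\<omega>. Z \<omega> * h \<omega> \<partial>M) = (\<integral>\<^sup>+\<omega>. Z \<omega> \<partial>density M h)"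
    by (subst nn_integral_density) (auto simp: mult.commute)
  also have "\<dots> = (\<integral>\<^sup>+\<omega>. Z \<omega> \<partial>restr_to_subalg (density M h) F)"
    using nn_integral_subalgebra2[OF sub' Z] by simp
  also have "\<dots> = K * (\<integral>\<^sup>+\<omega>. Z \<omega> \<partial>M)"
    unfolding eq using nn_integral_subalgebra2[OF sub Z] nn_integral_scale_measure[OF Zr] by simp
  finally show ?thesis .
qed

section \<open>Brownian increments and the maximal inequality on a finite grid\<close>

locale bm =
  fixes T :: real and M :: "'a measure" and F :: "real \<Rightarrow> 'a measure" and B :: "real \<Rightarrow> 'a \<Rightarrow> real"
  assumes T_pos: "0 < T" and brownian: "brownian_motion T M F B"
begin

sublocale prob_space M
  using brownian by (simp add: brownian_motion_def)

lemma subalgebra_F: "t \<in> {0..T} \<Longrightarrow> subalgebra M (F t)"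
  using brownian by (simp add: brownian_motion_def filtration_on_def)

lemma space_F: "t \<in> {0..T} \<Longrightarrow> space (F t) = space M"
  using subalgebra_F by (simp add: subalgebra_def)

lemma sets_F_le: "t \<in> {0..T} \<Longrightarrow> A \<in> sets (F t) \<Longrightarrow> A \<in> sets M"
  using subalgebra_F by (auto simp: subalgebra_def)

lemma sets_F_mono: "s \<in> {0..T} \<Longrightarrow> t \<in> {0..T} \<Longrightarrow> s \<le> t \<Longrightarrow> A \<in> sets (F s) \<Longrightarrow> A \<in> sets (F t)"
  using brownian unfolding brownian_motion_def filtration_on_def by blast

lemma adapted_mono:
  assumes "adapted_on T F X" "s \<in> {0..T}" "t \<in> {0..T}" "s \<le> t"
  shows "X s \<in> borel_measurable (F t)"
proof -
  have "subalgebra (F t) (F s)"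
    unfolding subalgebra_def using space_F[OF assms(2)] space_F[OF assms(3)] sets_F_mono[OF assms(2-4)] by blast
  then show ?thesis
    using assms(1,2) by (auto simp: adapted_on_def intro: measurable_from_subalg)
qed

lemma adapted_M: "adapted_on T F X \<Longrightarrow> t \<in> {0..T} \<Longrightarrow> X t \<in> borel_measurable M"
  by (meson adapted_on_def measurable_from_subalg subalgebra_F)

lemma adapted_B: "adapted_on T F B"
  using brownian by (simp add: brownian_motion_def)

lemma B_cont: "\<omega> \<in> space M \<Longrightarrow> continuous_on {0..T} (\<lambda>t. B t \<omega>)"
  using brownian by (simp add: brownian_motion_def continuous_process_def)

lemma B_0: "\<omega> \<in> space M \<Longrightarrow> B 0 \<omega> = 0"
  using brownian by (simp add: brownian_motion_def)

lemma increment_distributed: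
  "s \<in> {0..T} \<Longrightarrow> t \<in> {0..T} \<Longrightarrow> s < t \<Longrightarrow>
    distributed M lborel (\<lambda>\<omega>. B t \<omega> - B s \<omega>) (\<lambda>x. ennreal (normal_density 0 (sqrt (t - s)) x))"
  using brownian by (simp add: brownian_motion_def)

lemma increment_indep:
  "s \<in> {0..T} \<Longrightarrow> t \<in> {0..T} \<Longrightarrow> s < t \<Longrightarrow> A \<in> sets (F s) \<Longrightarrow> S \<in> sets borel \<Longrightarrow>
    measure M (A \<inter> {\<omega>\<in>space M. B t \<omega> - B s \<omega> \<in> S})
      = measure M A * measure M {\<omega>\<in>space M. B t \<omega> - B s \<omega> \<in> S}"
  using brownian by (simp add: brownian_motion_def)

text \<open>Independence is given for events only. It says that, under \<open>M\<close> restricted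
  to \<open>A\<close>, the increment has its usual law scaled by the mass of \<open>A\<close>;
  integrating \<open>f\<close> against these two equal measures gives the product.\<close>

lemma nn_integral_increment:
  assumes st: "s \<in> {0..T}" "t \<in> {0..T}" "s < t" and A: "A \<in> sets (F s)"
    and f [measurable]: "f \<in> borel_measurable borel"
  shows "(\<integral>\<^sup>+\<omega>. indicator A \<omega> * f (B t \<omega> - B s \<omega>) \<partial>M)
    = (\<integral>\<^sup>+x. ennreal (normal_density 0 (sqrt (t - s)) x) * f x \<partial>lborel) * emeasure M A"
proof -
  let ?X = "\<lambda>\<omega>. B t \<omega> - B s \<omega>"
  have [measurable]: "B t \<in> borel_measurable M" "B s \<in> borel_measurable M"
    using adapted_M[OF adapted_B] st by auto
  have AM [measurable]: "A \<in> sets M" using sets_F_le st A by blast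
  have eq: "distr (density M (indicator A)) borel ?X = scale_measure (emeasure M A) (distr M borel ?X)"
  proof (rule measure_eqI)
    fix S assume "S \<in> sets (distr (density M (indicator A)) borel ?X)"
    then have S [measurable]: "S \<in> sets borel" by simp
    have "emeasure (distr (density M (indicator A)) borel ?X) S
        = emeasure M (A \<inter> {\<omega>\<in>space M. ?X \<omega> \<in> S})"
      by (subst emeasure_distr)
        (auto simp: emeasure_density vimage_def Int_def conj_commute
          simp flip: indicator_inter_arith intro!: arg_cong2[where f=emeasure])
    also have "\<dots> = emeasure M A * emeasure M {\<omega>\<in>space M. ?X \<omega> \<in> S}"
      using increment_indep[OF st A S]
      by (simp add: emeasure_eq_measure ennreal_mult)
    also have "emeasure M {\<omega>\<in>space M. ?X \<omega> \<in> S} = emeasure (distr M borel ?X) S"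
      by (subst emeasure_distr) (auto simp: vimage_def Int_def conj_commute)
    finally show "emeasure (distr (density M (indicator A)) borel ?X) S
        = emeasure (scale_measure (emeasure M A) (distr M borel ?X)) S" by simp
  qed simp
  have "(\<integral>\<^sup>+\<omega>. indicator A \<omega> * f (?X \<omega>) \<partial>M) = (\<integral>\<^sup>+\<omega>. f (?X \<omega>) \<partial>density M (indicator A))"
    by (subst nn_integral_density) auto
  also have "\<dots> = (\<integral>\<^sup>+x. f x \<partial>distr (density M (indicator A)) borel ?X)"
    by (subst nn_integral_distr) auto
  also have "\<dots> = emeasure M A * (\<integral>\<^sup>+x. f x \<partial>distr M borel ?X)"
    unfolding eq by (subst nn_integral_scale_measure) auto
  also have "(\<integral>\<^sup>+x. f x \<partial>distr M borel ?X) = (\<integral>\<^sup>+\<omega>. f (?X \<omega>) \<partial>M)"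
    by (subst nn_integral_distr) auto
  also have "\<dots> = (\<integral>\<^sup>+x. ennreal (normal_density 0 (sqrt (t - s)) x) * f x \<partial>lborel)"
    by (rule distributed_nn_integral[symmetric, OF increment_distributed[OF st]]) simp
  finally show ?thesis by (simp add: mult.commute)
qed

text \<open>Martingale property of the exponential martingale, in a form with an arbitrary
  nonnegative weight from the past: the factor contributed by the increment is independent of
  \<open>F s\<close> and has mean 1.\<close>

lemma nn_integral_exp_increment:
  assumes st: "s \<in> {0..T}" "t \<in> {0..T}" "s \<le> t" and Z: "Z \<in> borel_measurable (F s)"
  shows "(\<integral>\<^sup>+\<omega>. Z \<omega> * ennreal (exp (l * (B t \<omega> - B s \<omega>) - l\<^sup>2 / 2 * (t - s))) \<partial>M) = (\<integral>\<^sup>+\<omega>. Z \<omega> \<partial>M)"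
proof (cases "s = t")
  case False
  then have lt: "s < t" using st by simp
  have [measurable]: "B t \<in> borel_measurable M" "B s \<in> borel_measurable M"
    using adapted_M[OF adapted_B] st by auto
  define f where "f x = ennreal (exp (l * x - l\<^sup>2 / 2 * (t - s)))" for x
  have [measurable]: "f \<in> borel_measurable borel" unfolding f_def by measurable
  have "(\<integral>\<^sup>+x. ennreal (normal_density 0 (sqrt (t - s)) x) * f x \<partial>lborel)
      = (\<integral>\<^sup>+x. ennreal (exp (- (l\<^sup>2 / 2 * (t - s)))) *
          (ennreal (normal_density 0 (sqrt (t - s)) x) * ennreal (exp (l * x))) \<partial>lborel)"
  proof (intro nn_integral_cong)
    fix x
    have "exp (l * x - l\<^sup>2 / 2 * (t - s)) = exp (- (l\<^sup>2 / 2 * (t - s))) * exp (l * x)"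
      by (simp flip: exp_add)
    then show "ennreal (normal_density 0 (sqrt (t - s)) x) * f x
        = ennreal (exp (- (l\<^sup>2 / 2 * (t - s)))) * (ennreal (normal_density 0 (sqrt (t - s)) x) * ennreal (exp (l * x)))"
      unfolding f_def by (simp add: mult_ac ennreal_mult)
  qed
  also have "\<dots> = ennreal (exp (- (l\<^sup>2 / 2 * (t - s)))) * ennreal (exp (l\<^sup>2 / 2 * (t - s)))"
    using nn_integral_exp_normal[of "sqrt (t - s)" l] lt by (subst nn_integral_cmult) auto
  also have "\<dots> = 1" by (simp flip: ennreal_mult exp_add)
  finally have one: "(\<integral>\<^sup>+x. ennreal (normal_density 0 (sqrt (t - s)) x) * f x \<partial>lborel) = 1" .
  have "(\<integral>\<^sup>+\<omega>. Z \<omega> * f (B t \<omega> - B s \<omega>) \<partial>M) = 1 * (\<integral>\<^sup>+\<omega>. Z \<omega> \<partial>M)"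
    using subalgebra_F[OF st(1)] Z
    by (rule nn_integral_mult_subalgebra) (auto simp: nn_integral_increment[OF st(1,2) lt] one)
  then show ?thesis by (simp add: f_def)
qed simp

text \<open>Doob's argument: the mass stopped at level \<open>exp \<beta>\<close> plus the mass of the surviving
  exponential martingale never exceeds the initial mass.\<close>

lemma discrete_exponential_maximal:
  fixes u :: "nat \<Rightarrow> real" and l \<beta> :: real
  assumes u: "\<And>i. u i \<in> {0..T}" "mono u" and D: "D \<in> sets (F (u 0))"
  defines "E \<equiv> \<lambda>i. {\<omega>\<in>space M. l * (B (u i) \<omega> - B (u 0) \<omega>) > \<beta> + l\<^sup>2 / 2 * (u i - u 0)}"
  shows "emeasure M (D \<inter> (\<Union>i\<le>n. E i)) \<le> ennreal (exp (- \<beta>)) * emeasure M D"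
proof -
  \<comment> \<open>\<open>Z\<close> is the exponential martingale normalised to 1 at
    \<open>u 0\<close>. \<open>H n\<close> is the part of \<open>D\<close> where it has exceeded
    \<open>exp \<beta>\<close> by index \<open>n\<close>, and \<open>S n\<close> the part that has
    survived.\<close>
  define Z where "Z i \<omega> = ennreal (exp (l * (B (u i) \<omega> - B (u 0) \<omega>) - l\<^sup>2 / 2 * (u i - u 0)))" for i \<omega>
  define H where "H n = D \<inter> (\<Union>i\<le>n. E i)" for n
  define S where "S n = D - (\<Union>i\<le>n. E i)" for n
  have BF: "B (u i) \<in> borel_measurable (F (u j))" if "i \<le> j" for i j
    using adapted_mono[OF adapted_B u(1) u(1)] monoD[OF u(2) that] by simp
  have EF: "E i \<in> sets (F (u j))" if "i \<le> j" for i j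
  proof -
    note BF[OF that, measurable] BF[of 0 j, simplified, measurable]
    have "{\<omega>\<in>space (F (u j)). l * (B (u i) \<omega> - B (u 0) \<omega>) > \<beta> + l\<^sup>2 / 2 * (u i - u 0)} \<in> sets (F (u j))"
      by measurable
    then show ?thesis using space_F[OF u(1)] by (simp add: E_def)
  qed
  have DF: "D \<in> sets (F (u j))" for j
    using sets_F_mono[OF u(1) u(1)] monoD[OF u(2), of 0 j] D by simp
  have HF: "H n \<in> sets (F (u n))" and SF: "S n \<in> sets (F (u n))" for n
    unfolding H_def S_def using DF EF by (auto intro!: sets.Int sets.Diff sets.finite_UN)
  have HM [measurable]: "H n \<in> sets M" and SM [measurable]: "S n \<in> sets M" for n
    using HF SF sets_F_le[OF u(1)] by blast+
  have EM [measurable]: "E i \<in> sets M" for i using EF[of i i] sets_F_le[OF u(1)] by blast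
  have ZF: "Z i \<in> borel_measurable (F (u j))" if "i \<le> j" for i j
  proof -
    note BF[OF that, measurable] BF[of 0 j, simplified, measurable]
    show ?thesis unfolding Z_def by measurable
  qed
  have ZM [measurable]: "Z i \<in> borel_measurable M" for i
    using measurable_from_subalg[OF subalgebra_F[OF u(1)] ZF[of i i]] by simp
  have ZE: "ennreal (exp \<beta>) \<le> Z i \<omega>" if "\<omega> \<in> E i" for i \<omega>
    using that unfolding Z_def E_def by (intro ennreal_leI) auto
  \<comment> \<open>Markov's inequality on \<open>A \<inter> E i\<close> that keeps the remaining
    mass outside \<open>E i\<close> instead of discarding it.\<close>
  have split: "ennreal (exp \<beta>) * emeasure M (A \<inter> E i) + (\<integral>\<^sup>+\<omega>. indicator (A - E i) \<omega> * Z i \<omega> \<partial>M)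
      \<le> (\<integral>\<^sup>+\<omega>. indicator A \<omega> * Z i \<omega> \<partial>M)" if [measurable]: "A \<in> sets M" for A i
  proof -
    have "ennreal (exp \<beta>) * emeasure M (A \<inter> E i) + (\<integral>\<^sup>+\<omega>. indicator (A - E i) \<omega> * Z i \<omega> \<partial>M)
      = (\<integral>\<^sup>+\<omega>. ennreal (exp \<beta>) * indicator (A \<inter> E i) \<omega> + indicator (A - E i) \<omega> * Z i \<omega> \<partial>M)"
      by (subst nn_integral_add) (auto simp: nn_integral_cmult_indicator)
    also have "\<dots> \<le> (\<integral>\<^sup>+\<omega>. indicator A \<omega> * Z i \<omega> \<partial>M)"
      using ZE by (intro nn_integral_mono) (auto split: split_indicator)
    finally show ?thesis .
  qed
  have *: "ennreal (exp \<beta>) * emeasure M (H n) + (\<integral>\<^sup>+\<omega>. indicator (S n) \<omega> * Z n \<omega> \<partial>M) \<le> emeasure M D" for n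
  proof (induction n)
    case 0
    have "(\<integral>\<^sup>+\<omega>. indicator D \<omega> * Z 0 \<omega> \<partial>M) = emeasure M D"
      using sets_F_le[OF u(1) D] by (simp add: Z_def)
    then show ?case using split[of D 0] sets_F_le[OF u(1) D] by (simp add: H_def S_def)
  next
    case (Suc n)
    have "H (Suc n) = H n \<union> (S n \<inter> E (Suc n))" and disj: "H n \<inter> (S n \<inter> E (Suc n)) = {}"
      by (auto simp: H_def S_def atMost_Suc)
    then have Hs: "emeasure M (H (Suc n)) = emeasure M (H n) + emeasure M (S n \<inter> E (Suc n))"
      by (simp add: plus_emeasure)
    have Ss: "S (Suc n) = S n - E (Suc n)" by (auto simp: S_def atMost_Suc)
    \<comment> \<open>The surviving set is known at time \<open>u n\<close>, so the next factor of
      the martingale integrates out over it.\<close>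
    have "(\<integral>\<^sup>+\<omega>. indicator (S n) \<omega> * Z (Suc n) \<omega> \<partial>M)
      = (\<integral>\<^sup>+\<omega>. (indicator (S n) \<omega> * Z n \<omega>) *
           ennreal (exp (l * (B (u (Suc n)) \<omega> - B (u n) \<omega>) - l\<^sup>2 / 2 * (u (Suc n) - u n))) \<partial>M)"
    proof (intro nn_integral_cong)
      fix \<omega>
      let ?e = "\<lambda>r i. l * (B (u i) \<omega> - B r \<omega>) - l\<^sup>2 / 2 * (u i - r)"
      have "?e (u 0) (Suc n) = ?e (u 0) n + ?e (u n) (Suc n)"
        by (simp add: algebra_simps diff_divide_distrib)
      then have "Z (Suc n) \<omega> = Z n \<omega> * ennreal (exp (?e (u n) (Suc n)))"
        unfolding Z_def by (simp add: exp_add ennreal_mult)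
      then show "indicator (S n) \<omega> * Z (Suc n) \<omega> = (indicator (S n) \<omega> * Z n \<omega>) *
           ennreal (exp (l * (B (u (Suc n)) \<omega> - B (u n) \<omega>) - l\<^sup>2 / 2 * (u (Suc n) - u n)))"
        by (simp add: mult.assoc)
    qed
    also have "\<dots> = (\<integral>\<^sup>+\<omega>. indicator (S n) \<omega> * Z n \<omega> \<partial>M)"
      using monoD[OF u(2), of n "Suc n"] SF[of n] ZF[of n n]
      by (intro nn_integral_exp_increment u) auto
    finally have mart: "(\<integral>\<^sup>+\<omega>. indicator (S n) \<omega> * Z (Suc n) \<omega> \<partial>M) = (\<integral>\<^sup>+\<omega>. indicator (S n) \<omega> * Z n \<omega> \<partial>M)" .
    have "ennreal (exp \<beta>) * emeasure M (H (Suc n)) + (\<integral>\<^sup>+\<omega>. indicator (S (Suc n)) \<omega> * Z (Suc n) \<omega> \<partial>M)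
      = ennreal (exp \<beta>) * emeasure M (H n) + (ennreal (exp \<beta>) * emeasure M (S n \<inter> E (Suc n))
          + (\<integral>\<^sup>+\<omega>. indicator (S n - E (Suc n)) \<omega> * Z (Suc n) \<omega> \<partial>M))"
      unfolding Hs Ss by (simp add: algebra_simps)
    also have "\<dots> \<le> ennreal (exp \<beta>) * emeasure M (H n) + (\<integral>\<^sup>+\<omega>. indicator (S n) \<omega> * Z n \<omega> \<partial>M)"
      using split[of "S n" "Suc n"] mart by (intro add_left_mono) auto
    finally show ?case using Suc.IH by (rule order_trans)
  qed
  have "emeasure M (H n) = ennreal (exp (- \<beta>)) * (ennreal (exp \<beta>) * emeasure M (H n))"
    by (simp flip: mult.assoc ennreal_mult exp_add)
  also have "\<dots> \<le> ennreal (exp (- \<beta>)) * emeasure M D"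
  proof (rule mult_left_mono)
    have "ennreal (exp \<beta>) * emeasure M (H n) \<le> ennreal (exp \<beta>) * emeasure M (H n)
        + (\<integral>\<^sup>+\<omega>. indicator (S n) \<omega> * Z n \<omega> \<partial>M)" by simp
    then show "ennreal (exp \<beta>) * emeasure M (H n) \<le> emeasure M D"
      using *[of n] by (rule order_trans)
  qed simp
  finally show ?thesis by (simp add: H_def)
qed

end

section \<open>From dyadic grids to continuous time\<close>

text \<open>Exceeding a level strictly is an open condition on a continuous path, and dyadic points
  are dense. The point is to replace an uncountable union over times by a countable one.\<close>

lemma dyadic_exceed:
  fixes f :: "real \<Rightarrow> real"
  assumes "continuous_on {s..T} f" "s \<le> T"
  shows "(\<exists>t\<in>{s..T}. c < f t) \<longleftrightarrow> (\<exists>n. \<exists>j\<le>2 ^ n. c < f (s + (T - s) * (real j / 2 ^ n)))"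
    (is "?L \<longleftrightarrow> ?R")
proof
  assume ?R
  then obtain n j where j: "j \<le> 2 ^ n" "c < f (s + (T - s) * (real j / 2 ^ n))" by blast
  have "real j \<le> 2 ^ n" using j(1) by (metis of_nat_le_iff of_nat_numeral of_nat_power)
  then have "real j / 2 ^ n \<in> {0..1}" by simp
  then have "s + (T - s) * (real j / 2 ^ n) \<in> {s..T}"
    using \<open>s \<le> T\<close> mult_left_le[of "real j / 2 ^ n" "T - s"] by auto
  then show ?L using j(2) by blast
next
  assume ?L
  then obtain t where t: "t \<in> {s..T}" "c < f t" by blast
  show ?R
  proof (cases "s = T")
    case True
    with t show ?thesis by (intro exI[of _ 0]) auto
  next
    case False
    with \<open>s \<le> T\<close> have "s < T" by simp
    define x where "x = (t - s) / (T - s)"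
    have x: "0 \<le> x" "x \<le> 1" "t = s + (T - s) * x"
      using t(1) \<open>s < T\<close> by (auto simp: x_def)
    \<comment> \<open>Rounding the relative position \<open>x\<close> down to the grid of mesh
      \<open>2 ^ (- n)\<close> gives grid points that converge to \<open>t\<close> and stay in the
      interval.\<close>
    define j where "j n = nat \<lfloor>2 ^ n * x\<rfloor>" for n :: nat
    have j: "real (j n) = of_int \<lfloor>2 ^ n * x\<rfloor>" for n
      using x by (simp add: j_def)
    have jle: "j n \<le> 2 ^ n" for n
    proof -
      have "2 ^ n * x \<le> 2 ^ n" using x by simp
      then have "real (j n) \<le> 2 ^ n" using j[of n] of_int_floor_le[of "2 ^ n * x"] by linarith
      then show ?thesis by (metis of_nat_le_iff of_nat_numeral of_nat_power)
    qed
    have lower: "x - (1/2) ^ n \<le> real (j n) / 2 ^ n" and upper: "real (j n) / 2 ^ n \<le> x" for n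
    proof -
      have "2 ^ n * x - 1 \<le> real (j n)" "real (j n) \<le> 2 ^ n * x" unfolding j by linarith+
      then show "x - (1/2) ^ n \<le> real (j n) / 2 ^ n" "real (j n) / 2 ^ n \<le> x"
        by (simp_all add: pos_le_divide_eq pos_divide_le_eq left_diff_distrib right_diff_distrib power_one_over mult.commute)
    qed
    have "(\<lambda>n. x - (1/2) ^ n) \<longlonglongrightarrow> x - 0"
      by (intro tendsto_intros LIMSEQ_realpow_zero) auto
    then have "(\<lambda>n. real (j n) / 2 ^ n) \<longlonglongrightarrow> x"
      by (intro tendsto_sandwich[OF always_eventually always_eventually _ tendsto_const, OF allI allI, OF lower upper]) simp
    then have lim: "(\<lambda>n. s + (T - s) * (real (j n) / 2 ^ n)) \<longlonglongrightarrow> t"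
      unfolding x(3) by (intro tendsto_intros)
    have mem: "s + (T - s) * (real (j n) / 2 ^ n) \<in> {s..T}" for n
    proof -
      have "0 \<le> real (j n) / 2 ^ n" "real (j n) / 2 ^ n \<le> 1"
        using order_trans[OF upper x(2)] by (simp, blast)
      then show ?thesis using \<open>s < T\<close> mult_left_le[of "real (j n) / 2 ^ n" "T - s"] by auto
    qed
    have "(\<lambda>n. f (s + (T - s) * (real (j n) / 2 ^ n))) \<longlonglongrightarrow> f t"
      using mem by (intro continuous_on_tendsto_compose[OF assms(1) lim t(1)]) auto
    then have "\<forall>\<^sub>F n in sequentially. c < f (s + (T - s) * (real (j n) / 2 ^ n))"
      using t(2) by (rule order_tendstoD)
    then show ?thesis using jle by (auto simp: eventually_sequentially)
  qed
qed

lemma exceed_in_sets: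
  fixes s T :: real
  assumes "s \<le> T" and meas: "\<And>t. t \<in> {s..T} \<Longrightarrow> X t \<in> borel_measurable M"
    and cont: "\<And>\<omega>. \<omega> \<in> space M \<Longrightarrow> continuous_on {s..T} (\<lambda>t. X t \<omega> :: real)"
  shows "{\<omega>\<in>space M. \<exists>t\<in>{s..T}. c < X t \<omega>} \<in> sets M"
proof -
  have eq: "{\<omega>\<in>space M. \<exists>t\<in>{s..T}. c < X t \<omega>}
    = (\<Union>n. \<Union>j\<in>{..2 ^ n}. {\<omega>\<in>space M. c < X (s + (T - s) * (real j / 2 ^ n)) \<omega>})"
  proof -
    have "(\<exists>t\<in>{s..T}. c < X t \<omega>) \<longleftrightarrow> (\<exists>n. \<exists>j\<le>2 ^ n. c < X (s + (T - s) * (real j / 2 ^ n)) \<omega>)"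
      if "\<omega> \<in> space M" for \<omega>
      using dyadic_exceed[OF cont[OF that] \<open>s \<le> T\<close>] .
    then show ?thesis by blast
  qed
  have "{\<omega>\<in>space M. c < X (s + (T - s) * (real j / 2 ^ n)) \<omega>} \<in> sets M" if "j \<le> 2 ^ n" for n j :: nat
  proof -
    have "real j \<le> 2 ^ n" using that by (metis of_nat_le_iff of_nat_numeral of_nat_power)
    then have "real j / 2 ^ n \<in> {0..1}" by simp
    then have "s + (T - s) * (real j / 2 ^ n) \<in> {s..T}"
      using \<open>s \<le> T\<close> mult_left_le[of "real j / 2 ^ n" "T - s"] by auto
    from meas[OF this] show ?thesis by measurable
  qed
  then show ?thesis unfolding eq by (intro sets.countable_UN' sets.finite_UN) auto
qed

context bm begin

text \<open>The event says that the exponential martingale started at time \<open>s\<close> exceeds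
  \<open>exp \<beta>\<close> at some later time. Along nested dyadic grids the discrete events
  increase to it, so the bound, which is the same for every grid, survives by continuity from
  below.\<close>

lemma exponential_maximal:
  fixes l \<beta> :: real
  assumes s: "s \<in> {0..T}" and D: "D \<in> sets (F s)"
  defines "E \<equiv> {\<omega>\<in>space M. \<exists>t\<in>{s..T}. \<beta> + l\<^sup>2 / 2 * (t - s) < l * (B t \<omega> - B s \<omega>)}"
  shows "E \<in> sets M" "measure M (D \<inter> E) \<le> exp (- \<beta>) * measure M D"
proof -
  define X where "X t \<omega> = l * (B t \<omega> - B s \<omega>) - l\<^sup>2 / 2 * (t - s)" for t \<omega>
  have E: "E = {\<omega>\<in>space M. \<exists>t\<in>{s..T}. \<beta> < X t \<omega>}"
    unfolding E_def X_def by (auto simp: algebra_simps)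
  have BM: "t \<in> {0..T} \<Longrightarrow> B t \<in> borel_measurable M" for t using adapted_M[OF adapted_B] .
  have cont: "continuous_on {s..T} (\<lambda>t. X t \<omega>)" if "\<omega> \<in> space M" for \<omega>
    unfolding X_def using s by (intro continuous_intros continuous_on_subset[OF B_cont[OF that]]) auto
  show "E \<in> sets M"
    unfolding E
  proof (rule exceed_in_sets)
    fix t assume "t \<in> {s..T}"
    then have [measurable]: "B t \<in> borel_measurable M" "B s \<in> borel_measurable M" using BM s by auto
    show "X t \<in> borel_measurable M" unfolding X_def by measurable
  qed (use s cont in auto)
  \<comment> \<open>The minimum stops the grid at \<open>T\<close> after index \<open>2 ^ n\<close>,
    so that it is monotone and inside the interval for all indices, as the discrete inequality
    requires.\<close>
  define u where "u n i = s + (T - s) * (real (min i (2 ^ n)) / 2 ^ n)" for n i :: nat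
  define G where "G n = D \<inter> (\<Union>i\<le>2 ^ n. {\<omega>\<in>space M. l * (B (u n i) \<omega> - B (u n 0) \<omega>) > \<beta> + l\<^sup>2 / 2 * (u n i - u n 0)})" for n
  have u0: "u n 0 = s" for n by (simp add: u_def)
  have u_mem: "u n i \<in> {s..T}" for n i
  proof -
    have "real (min i (2 ^ n)) \<le> 2 ^ n"
      by (metis min.cobounded2 of_nat_le_iff of_nat_numeral of_nat_power)
    then have "real (min i (2 ^ n)) / 2 ^ n \<in> {0..1}" by simp
    then show ?thesis
      using s mult_left_le[of "real (min i (2 ^ n)) / 2 ^ n" "T - s"] by (auto simp: u_def)
  qed
  have u_mono: "mono (u n)" for n
    unfolding u_def using s by (intro monoI add_left_mono mult_left_mono divide_right_mono) auto
  have G: "emeasure M (G n) \<le> ennreal (exp (- \<beta>)) * emeasure M D" for n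
    unfolding G_def
    by (rule discrete_exponential_maximal) (use u_mem s u0 u_mono D in \<open>auto intro: order_trans\<close>)
  have DM: "D \<in> sets M" using sets_F_le[OF s D] .
  have GM: "G n \<in> sets M" for n
  proof -
    have "{\<omega>\<in>space M. l * (B (u n i) \<omega> - B (u n 0) \<omega>) > \<beta> + l\<^sup>2 / 2 * (u n i - u n 0)} \<in> sets M" for i
    proof -
      have [measurable]: "B (u n j) \<in> borel_measurable M" for j using u_mem[of n j] s by (intro BM) auto
      show ?thesis by measurable
    qed
    then show ?thesis unfolding G_def using DM by auto
  qed
  have DE: "D \<inter> E = (\<Union>n. G n)"
  proof -
    have E_iff: "\<omega> \<in> E \<longleftrightarrow> (\<exists>n. \<exists>i\<le>2 ^ n. \<beta> < X (u n i) \<omega>)" if "\<omega> \<in> space M" for \<omega>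
      unfolding E using that dyadic_exceed[OF cont[OF that], of \<beta>] s by (auto simp: u_def min_def)
    have G_iff: "\<omega> \<in> G n \<longleftrightarrow> \<omega> \<in> D \<and> (\<exists>i\<le>2 ^ n. \<beta> < X (u n i) \<omega>)" for \<omega> n
      using sets.sets_into_space[OF DM] unfolding G_def u0 X_def by (auto simp: less_diff_eq)
    show ?thesis
    proof (rule set_eqI)
      fix \<omega>
      show "\<omega> \<in> D \<inter> E \<longleftrightarrow> \<omega> \<in> (\<Union>n. G n)"
        using E_iff[of \<omega>] sets.sets_into_space[OF DM] unfolding UN_iff G_iff by auto
    qed
  qed
  have "incseq G"
  proof (rule incseq_SucI, rule subsetI)
    fix n \<omega> assume "\<omega> \<in> G n"
    then obtain i where i: "i \<le> 2 ^ n" "\<omega> \<in> D" "\<omega> \<in> space M"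
      "l * (B (u n i) \<omega> - B (u n 0) \<omega>) > \<beta> + l\<^sup>2 / 2 * (u n i - u n 0)"
      by (auto simp: G_def)
    \<comment> \<open>Point \<open>i\<close> of one grid is point \<open>2 * i\<close> of the next,
      hence the events increase.\<close>
    have "u (Suc n) (2 * i) = u n i" using i(1) by (simp add: u_def)
    then show "\<omega> \<in> G (Suc n)" using i unfolding G_def u0 by (auto intro!: bexI[of _ "2 * i"])
  qed
  then have "emeasure M (\<Union>n. G n) = (SUP n. emeasure M (G n))"
    using GM by (intro SUP_emeasure_incseq[symmetric]) auto
  also have "\<dots> \<le> ennreal (exp (- \<beta>)) * emeasure M D"
    using G by (intro SUP_least) auto
  finally have "emeasure M (D \<inter> E) \<le> ennreal (exp (- \<beta>)) * emeasure M D" unfolding DE .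
  then show "measure M (D \<inter> E) \<le> exp (- \<beta>) * measure M D"
    by (simp add: emeasure_eq_measure flip: ennreal_mult)
qed

text \<open>The one-sided bound is applied with \<open>l\<close> and with \<open>- l\<close>, which
  costs the factor 2. Dividing by \<open>l\<close> turns the level into a line of offset
  \<open>\<beta> / l\<close> and slope \<open>l / 2\<close>, both of which can be tuned through
  \<open>l\<close>.\<close>

lemma exponential_maximal_abs:
  fixes l \<beta> :: real
  assumes s: "s \<in> {0..T}" and D: "D \<in> sets (F s)" and l: "0 < l"
  defines "E \<equiv> {\<omega>\<in>space M. \<exists>t\<in>{s..T}. \<beta> / l + l / 2 * (t - s) < \<bar>B t \<omega> - B s \<omega>\<bar>}"
  shows "E \<in> sets M" "measure M (D \<inter> E) \<le> 2 * exp (- \<beta>) * measure M D"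
proof -
  let ?E = "\<lambda>l. {\<omega>\<in>space M. \<exists>t\<in>{s..T}. \<beta> + l\<^sup>2 / 2 * (t - s) < l * (B t \<omega> - B s \<omega>)}"
  have "\<beta> / l + l / 2 * d < \<bar>x\<bar> \<longleftrightarrow> \<beta> + l\<^sup>2 / 2 * d < l * x \<or> \<beta> + (- l)\<^sup>2 / 2 * d < - l * x" for d x :: real
  proof -
    have "\<beta> / l + l / 2 * d < \<bar>x\<bar> \<longleftrightarrow> l * (\<beta> / l + l / 2 * d) < l * \<bar>x\<bar>"
      using l by simp
    also have "l * (\<beta> / l + l / 2 * d) = \<beta> + l\<^sup>2 / 2 * d"
      using l by (simp add: field_simps power2_eq_square)
    also have "l * \<bar>x\<bar> = \<bar>l * x\<bar>" using l by (simp add: abs_mult)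
    finally have "\<beta> / l + l / 2 * d < \<bar>x\<bar> \<longleftrightarrow> \<beta> + l\<^sup>2 / 2 * d < \<bar>l * x\<bar>" .
    moreover have "a < \<bar>y\<bar> \<longleftrightarrow> a < y \<or> a < - y" for a y :: real by arith
    ultimately show ?thesis by simp
  qed
  then have E: "E = ?E l \<union> ?E (- l)" unfolding E_def by blast
  have S: "?E l \<in> sets M" "?E (- l) \<in> sets M"
    using exponential_maximal(1)[OF s D] by blast+
  then show "E \<in> sets M" unfolding E by blast
  have "measure M (D \<inter> E) \<le> measure M (D \<inter> ?E l) + measure M (D \<inter> ?E (- l))"
    unfolding E Int_Un_distrib using S sets_F_le[OF s D]
    by (intro measure_Un_le) auto
  also have "\<dots> \<le> 2 * exp (- \<beta>) * measure M D"
    using exponential_maximal(2)[OF s D, of \<beta> l] exponential_maximal(2)[OF s D, of \<beta> "- l"] by simp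
  finally show "measure M (D \<inter> E) \<le> 2 * exp (- \<beta>) * measure M D" .
qed

section \<open>Large increments: lower tail bound and repeated trials\<close>

text \<open>With \<open>\<sigma> = sqrt (t - s)\<close>, the Gaussian density on the interval from
  \<open>z * \<sigma>\<close> to \<open>(z + 1) * \<sigma>\<close> is at least its value at the
  right end, and the interval has length \<open>\<sigma>\<close>.\<close>

lemma increment_tail_ge:
  assumes st: "s \<in> {0..T}" "t \<in> {0..T}" "s < t" and z: "0 \<le> z"
  shows "exp (- (z + 1)\<^sup>2 / 2) / sqrt (2 * pi) \<le> measure M {\<omega>\<in>space M. z * sqrt (t - s) \<le> B t \<omega> - B s \<omega>}"
proof -
  define \<sigma> where "\<sigma> = sqrt (t - s)"
  have \<sigma>: "0 < \<sigma>" using st by (simp add: \<sigma>_def)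
  define c where "c = exp (- (z + 1)\<^sup>2 / 2) / sqrt (2 * pi)"
  have "c = (c / \<sigma>) * (z * \<sigma> + \<sigma> - z * \<sigma>)" using \<sigma> by simp
  then have "ennreal c = ennreal (c / \<sigma>) * emeasure lborel {z * \<sigma>..z * \<sigma> + \<sigma>}"
    using \<sigma> by (simp add: c_def flip: ennreal_mult)
  also have "\<dots> = (\<integral>\<^sup>+x. ennreal (c / \<sigma>) * indicator {z * \<sigma>..z * \<sigma> + \<sigma>} x \<partial>lborel)"
    by (rule nn_integral_cmult_indicator[symmetric]) simp
  also have "\<dots> \<le> (\<integral>\<^sup>+x. ennreal (normal_density 0 \<sigma> x) * indicator {z * \<sigma>..} x \<partial>lborel)"
  proof (intro nn_integral_mono)
    fix x :: real
    have "c / \<sigma> \<le> normal_density 0 \<sigma> x" if x: "z * \<sigma> \<le> x" "x \<le> z * \<sigma> + \<sigma>"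
    proof -
      have "0 \<le> z * \<sigma>" using z \<sigma> by simp
      have "x\<^sup>2 \<le> ((z + 1) * \<sigma>)\<^sup>2"
        using x \<open>0 \<le> z * \<sigma>\<close> by (intro power_mono) (auto simp: algebra_simps)
      then have "x\<^sup>2 \<le> (z + 1)\<^sup>2 * \<sigma>\<^sup>2" by (simp only: power_mult_distrib)
      then have "x\<^sup>2 / (2 * \<sigma>\<^sup>2) \<le> (z + 1)\<^sup>2 / 2"
        using \<sigma> by (simp add: pos_divide_le_eq)
      then have "exp (- (z + 1)\<^sup>2 / 2) \<le> exp (- x\<^sup>2 / (2 * \<sigma>\<^sup>2))" by simp
      then have "c / \<sigma> \<le> exp (- x\<^sup>2 / (2 * \<sigma>\<^sup>2)) / sqrt (2 * pi) / \<sigma>"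
        unfolding c_def using \<sigma> by (intro divide_right_mono) auto
      also have "\<dots> = normal_density 0 \<sigma> x"
        using \<sigma> by (simp add: normal_density_def real_sqrt_mult)
      finally show ?thesis .
    qed
    then show "ennreal (c / \<sigma>) * indicator {z * \<sigma>..z * \<sigma> + \<sigma>} x
        \<le> ennreal (normal_density 0 \<sigma> x) * indicator {z * \<sigma>..} x"
      by (auto split: split_indicator intro!: ennreal_leI)
  qed
  also have "\<dots> = emeasure M ((\<lambda>\<omega>. B t \<omega> - B s \<omega>) -` {z * \<sigma>..} \<inter> space M)"
    unfolding \<sigma>_def by (rule distributed_emeasure[symmetric, OF increment_distributed[OF st]]) simp
  also have "(\<lambda>\<omega>. B t \<omega> - B s \<omega>) -` {z * \<sigma>..} \<inter> space M = {\<omega>\<in>space M. z * \<sigma> \<le> B t \<omega> - B s \<omega>}"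
    by auto
  finally show ?thesis by (simp add: emeasure_eq_measure c_def \<sigma>_def)
qed

text \<open>The absence of a large increment so far is known at the last grid time, hence
  independent of the next increment. Each step thus contributes a factor of at most one minus the
  tail bound.\<close>

lemma no_large_increment:
  fixes h z :: real and N :: nat
  assumes h: "0 < h" "real N * h \<le> T" and z: "0 \<le> z"
  defines "S \<equiv> \<lambda>n. {\<omega>\<in>space M. \<forall>i<n. B (real (Suc i) * h) \<omega> - B (real i * h) \<omega> < z * sqrt h}"
  shows "S N \<in> sets M" "measure M (S N) \<le> (1 - exp (- (z + 1)\<^sup>2 / 2) / sqrt (2 * pi)) ^ N"
proof -
  define p where "p = exp (- (z + 1)\<^sup>2 / 2) / sqrt (2 * pi)"
  have mem: "real n * h \<in> {0..T}" if "n \<le> N" for n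
  proof -
    have "real n * h \<le> real N * h" using that h by (intro mult_right_mono) auto
    from order_trans[OF this h(2)] show ?thesis using h by simp
  qed
  have SF: "S n \<in> sets (F (real n * h))" if "n \<le> N" for n
  proof -
    let ?F = "F (real n * h)"
    have [measurable]: "B (real i * h) \<in> borel_measurable ?F" if "i \<le> n" for i
      using that \<open>n \<le> N\<close> h mem by (intro adapted_mono[OF adapted_B] mem) auto
    have "(\<Inter>i<n. {\<omega>\<in>space ?F. B (real (Suc i) * h) \<omega> - B (real i * h) \<omega> < z * sqrt h}) \<in> sets ?F" if "0 < n"
    proof (intro sets.finite_INT)
      fix i assume "i \<in> {..<n}"
      then have [measurable]: "B (real (Suc i) * h) \<in> borel_measurable ?F" "B (real i * h) \<in> borel_measurable ?F"
        by (auto simp del: of_nat_Suc)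
      show "{\<omega>\<in>space ?F. B (real (Suc i) * h) \<omega> - B (real i * h) \<omega> < z * sqrt h} \<in> sets ?F" by measurable
    qed (use that in auto)
    moreover have "S n = (\<Inter>i<n. {\<omega>\<in>space ?F. B (real (Suc i) * h) \<omega> - B (real i * h) \<omega> < z * sqrt h})" if "0 < n"
      unfolding S_def space_F[OF mem[OF \<open>n \<le> N\<close>]] using that by auto
    \<comment> \<open>Separate case: an intersection over the empty index set would be
      \<open>UNIV\<close>, not the space.\<close>
    moreover have "S 0 = space (F (real 0 * h))" unfolding S_def using space_F[OF mem[of 0]] by simp
    ultimately show ?thesis by (cases "n = 0") auto
  qed
  show "S N \<in> sets M" using sets_F_le[OF mem SF] by simp
  have "measure M (S n) \<le> (1 - p) ^ n" if "n \<le> N" for n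
    using that
  proof (induction n)
    case 0
    show ?case by simp
  next
    case (Suc n)
    let ?s = "real n * h" and ?t = "real (Suc n) * h"
    have st: "?s \<in> {0..T}" "?t \<in> {0..T}" "?s < ?t" and d: "?t - ?s = h"
      using mem[of n] mem[of "Suc n"] Suc.prems h by (auto simp: algebra_simps)
    let ?L = "{\<omega>\<in>space M. B ?t \<omega> - B ?s \<omega> \<in> {..<z * sqrt h}}"
    have [measurable]: "B ?t \<in> borel_measurable M" "B ?s \<in> borel_measurable M"
      using adapted_M[OF adapted_B] st by auto
    have LM: "?L \<in> sets M" by measurable
    have "{\<omega>\<in>space M. z * sqrt h \<le> B ?t \<omega> - B ?s \<omega>} = space M - ?L" by auto
    then have "measure M {\<omega>\<in>space M. z * sqrt h \<le> B ?t \<omega> - B ?s \<omega>} = 1 - measure M ?L"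
      using prob_compl[OF LM] by simp
    then have "measure M ?L \<le> 1 - p"
      using increment_tail_ge[OF st z, unfolded d] by (simp add: p_def)
    have "S (Suc n) = S n \<inter> ?L"
      unfolding S_def less_Suc_eq by auto
    then have "measure M (S (Suc n)) = measure M (S n) * measure M ?L"
      using increment_indep[OF st SF[of n], of "{..<z * sqrt h}"] Suc.prems by simp
    also have "\<dots> \<le> (1 - p) ^ n * (1 - p)"
      using Suc \<open>measure M ?L \<le> 1 - p\<close> by (intro mult_mono) (auto intro: order_trans[OF measure_nonneg])
    finally show ?case by (simp add: mult.commute)
  qed
  then show "measure M (S N) \<le> (1 - exp (- (z + 1)\<^sup>2 / 2) / sqrt (2 * pi)) ^ N"
    by (simp add: p_def)
qed

end

section \<open>Functionals of continuous paths\<close>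

lemma sup_dist_le:
  assumes "0 \<le> T" "\<And>t. t \<in> {0..T} \<Longrightarrow> \<bar>f t - g t\<bar> \<le> e"
  shows "sup_dist T f g \<le> e"
  unfolding sup_dist_def using assms by (intro cSUP_least) auto

text \<open>The coefficients are a free argument, so this is a map from real sequences to continuous
  paths. Composing a functional with it gives a function of finitely many coordinates, to which the
  product sigma-algebra applies.\<close>

definition bernstein_poly :: "real \<Rightarrow> nat \<Rightarrow> (nat \<Rightarrow> real) \<Rightarrow> real \<Rightarrow> real" where
  "bernstein_poly T n x t = (\<Sum>k\<le>n. x k * Bernstein n k (t / T))"

text \<open>The minimum keeps the nodes inside \<open>{0..T}\<close> for every index \<open>k\<close>.\<close>

definition bernstein_node :: "real \<Rightarrow> nat \<Rightarrow> nat \<Rightarrow> real" where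
  "bernstein_node T n k = T * (real (min k n) / real n)"

lemma bernstein_node_mem: "0 \<le> T \<Longrightarrow> bernstein_node T n k \<in> {0..T}"
proof -
  assume "0 \<le> T"
  moreover have "real (min k n) / real n \<le> 1" by (cases "n = 0") (auto simp: divide_le_eq_1)
  ultimately show ?thesis
    using mult_left_le[of "real (min k n) / real n" T] by (simp add: bernstein_node_def)
qed

lemma continuous_bernstein_poly: "continuous_on A (bernstein_poly T n x)"
proof (cases "T = 0")
  case True
  then show ?thesis unfolding bernstein_poly_def Bernstein_def by simp
next
  case False
  then show ?thesis
    unfolding bernstein_poly_def Bernstein_def by (intro continuous_intros) auto
qed

text \<open>The basis polynomials are nonnegative and sum to 1, so the map from coefficients to
  paths is Lipschitz for the sum of absolute differences.\<close>

lemma sup_dist_bernstein_poly: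
  assumes "0 < T"
  shows "sup_dist T (bernstein_poly T n x) (bernstein_poly T n y) \<le> (\<Sum>k\<le>n. \<bar>x k - y k\<bar>)"
proof (rule sup_dist_le)
  fix t assume t: "t \<in> {0..T}"
  have B: "0 \<le> Bernstein n k (t / T)" for k
    using t assms by (intro Bernstein_nonneg) auto
  have B1: "Bernstein n k (t / T) \<le> 1" if "k \<le> n" for k
    using member_le_sum[of k "{..n}" "\<lambda>k. Bernstein n k (t / T)"] B that by simp
  have "\<bar>bernstein_poly T n x t - bernstein_poly T n y t\<bar> = \<bar>\<Sum>k\<le>n. (x k - y k) * Bernstein n k (t / T)\<bar>"
    by (simp add: bernstein_poly_def sum_subtractf left_diff_distrib)
  also have "\<dots> \<le> (\<Sum>k\<le>n. \<bar>x k - y k\<bar> * Bernstein n k (t / T))"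
    using B by (intro order_trans[OF sum_abs]) (simp add: abs_mult)
  also have "\<dots> \<le> (\<Sum>k\<le>n. \<bar>x k - y k\<bar>)"
    using B1 by (intro sum_mono) (simp add: mult_left_le)
  finally show "\<bar>bernstein_poly T n x t - bernstein_poly T n y t\<bar> \<le> (\<Sum>k\<le>n. \<bar>x k - y k\<bar>)" .
qed (use assms in simp)

lemma bernstein_poly_approx:
  assumes T: "0 < T" and f: "continuous_on {0..T} f" and e: "0 < e"
  shows "\<forall>\<^sub>F n in sequentially. sup_dist T f (bernstein_poly T n (\<lambda>k. f (bernstein_node T n k))) < e"
proof -
  have "continuous_on {0..1} (\<lambda>x. f (T * x))"
    using T by (intro continuous_on_compose2[OF f] continuous_intros) (auto simp: mult_left_le)
  \<comment> \<open>Half of \<open>e\<close> is used because passing to the supremum weakens strict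
    inequalities.\<close>
  from Bernstein_Weierstrass[OF this half_gt_zero[OF e]]
  obtain N where N: "\<And>n x. N \<le> n \<Longrightarrow> x \<in> {0..1} \<Longrightarrow>
      \<bar>f (T * x) - (\<Sum>k\<le>n. f (T * (real k / real n)) * Bernstein n k x)\<bar> < e / 2" by auto
  have "sup_dist T f (bernstein_poly T n (\<lambda>k. f (bernstein_node T n k))) \<le> e / 2" if "N \<le> n" for n
  proof (rule sup_dist_le)
    fix t assume t: "t \<in> {0..T}"
    have "bernstein_poly T n (\<lambda>k. f (bernstein_node T n k)) t
        = (\<Sum>k\<le>n. f (T * (real k / real n)) * Bernstein n k (t / T))"
      unfolding bernstein_poly_def bernstein_node_def by (intro sum.cong) (auto simp: min_def)
    then show "\<bar>f t - bernstein_poly T n (\<lambda>k. f (bernstein_node T n k)) t\<bar> \<le> e / 2"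
      using N[OF that, of "t / T"] t T by simp
  qed (use T in simp)
  then show ?thesis using e unfolding eventually_sequentially
    by (intro exI[of _ N]) (fastforce intro: le_less_trans[where y="e / 2"])
qed

text \<open>The composition is continuous for the product topology on real sequences, whose Borel
  sets are those of the product sigma-algebra because the index set is countable.\<close>

lemma borel_measurable_bernstein_functional:
  assumes T: "0 < T" and \<Phi>: "bcont_functional T \<Phi>"
  shows "(\<lambda>x. \<Phi> (bernstein_poly T n x)) \<in> borel_measurable (Pi\<^sub>M UNIV (\<lambda>_. borel))"
proof -
  have "continuous_on UNIV (\<lambda>x. \<Phi> (bernstein_poly T n x))"
    unfolding continuous_on_eq_continuous_at[OF open_UNIV] isCont_def
  proof (intro ballI tendstoI)
    fix x :: "nat \<Rightarrow> real" and e :: real assume "0 < e"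
    then obtain d where d: "0 < d" "\<And>g. continuous_on {0..T} g \<Longrightarrow>
        sup_dist T (bernstein_poly T n x) g < d \<Longrightarrow> \<bar>\<Phi> g - \<Phi> (bernstein_poly T n x)\<bar> < e"
      using \<Phi> continuous_bernstein_poly unfolding bcont_functional_def by meson
    have "continuous_on UNIV (\<lambda>y::nat \<Rightarrow> real. \<Sum>k\<le>n. \<bar>x k - y k\<bar>)"
      by (intro continuous_intros continuous_on_product_coordinates)
    then have "((\<lambda>y::nat \<Rightarrow> real. \<Sum>k\<le>n. \<bar>x k - y k\<bar>) \<longlongrightarrow> (\<Sum>k\<le>n. \<bar>x k - x k\<bar>)) (at x)"
      unfolding continuous_on_eq_continuous_at[OF open_UNIV] isCont_def by (rule bspec) simp
    then have "\<forall>\<^sub>F y in at x. (\<Sum>k\<le>n. \<bar>x k - y k\<bar>) < d"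
      using d(1) by (intro order_tendstoD(2)[of _ "\<Sum>k\<le>n. \<bar>x k - x k\<bar>"]) auto
    then show "\<forall>\<^sub>F y in at x. dist (\<Phi> (bernstein_poly T n y)) (\<Phi> (bernstein_poly T n x)) < e"
    proof eventually_elim
      case (elim y)
      then show ?case
        using d(2)[OF continuous_bernstein_poly] sup_dist_bernstein_poly[OF T, of n x y]
        by (simp add: dist_real_def)
    qed
  qed
  then have "(\<lambda>x. \<Phi> (bernstein_poly T n x)) \<in> borel_measurable borel"
    by (rule borel_measurable_continuous_onI)
  then show ?thesis
    using measurable_cong_sets[OF sets_PiM_equal_borel refl] by blast
qed

lemma bcont_functional_bernstein_tendsto:
  assumes T: "0 < T" and \<Phi>: "bcont_functional T \<Phi>" and f: "continuous_on {0..T} f"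
  shows "(\<lambda>n. \<Phi> (bernstein_poly T n (\<lambda>k. f (bernstein_node T n k)))) \<longlonglongrightarrow> \<Phi> f"
proof (rule tendstoI)
  fix e :: real assume "0 < e"
  then obtain d where d: "0 < d" "\<And>g. continuous_on {0..T} g \<Longrightarrow> sup_dist T f g < d \<Longrightarrow> \<bar>\<Phi> g - \<Phi> f\<bar> < e"
    using \<Phi> f unfolding bcont_functional_def by meson
  show "\<forall>\<^sub>F n in sequentially. dist (\<Phi> (bernstein_poly T n (\<lambda>k. f (bernstein_node T n k)))) (\<Phi> f) < e"
    using bernstein_poly_approx[OF T f d(1)]
    by eventually_elim (simp add: dist_real_def d(2) continuous_bernstein_poly)
qed

section \<open>Measurability, expectations and laws of path functionals\<close>

context
  fixes T :: real and M :: "'a measure" and X :: "real \<Rightarrow> 'a \<Rightarrow> real"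
  assumes T: "0 < T" and M: "prob_space M"
    and X: "\<And>t. t \<in> {0..T} \<Longrightarrow> X t \<in> borel_measurable M" "continuous_process T M X"
begin

lemma borel_measurable_bernstein_process:
  assumes "bcont_functional T \<Phi>"
  shows "(\<lambda>\<omega>. \<Phi> (bernstein_poly T n (\<lambda>k. X (bernstein_node T n k) \<omega>))) \<in> borel_measurable M"
proof -
  have "(\<lambda>\<omega> k. X (bernstein_node T n k) \<omega>) \<in> measurable M (Pi\<^sub>M UNIV (\<lambda>_. borel))"
    using X(1) bernstein_node_mem T by (intro measurable_abs_UNIV) auto
  from measurable_compose[OF this borel_measurable_bernstein_functional[OF T assms]] show ?thesis .
qed

lemma bernstein_process_tendsto:
  assumes "bcont_functional T \<Phi>" "\<omega> \<in> space M"
  shows "(\<lambda>n. \<Phi> (bernstein_poly T n (\<lambda>k. X (bernstein_node T n k) \<omega>))) \<longlonglongrightarrow> \<Phi> (\<lambda>t. X t \<omega>)"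
  using bcont_functional_bernstein_tendsto[OF T assms(1), of "\<lambda>t. X t \<omega>"] X(2) assms(2)
  by (simp add: continuous_process_def)

text \<open>The functional is a pointwise limit of functionals of finitely many values of the
  process, so its measurability along the process follows from that of the single
  coordinates.\<close>

lemma borel_measurable_bcont_functional:
  assumes "bcont_functional T \<Phi>"
  shows "(\<lambda>\<omega>. \<Phi> (\<lambda>t. X t \<omega>)) \<in> borel_measurable M"
  using bernstein_process_tendsto[OF assms] borel_measurable_bernstein_process[OF assms]
  by (rule borel_measurable_LIMSEQ_real)

lemma integrable_bcont_functional:
  assumes "bcont_functional T \<Phi>"
  shows "integrable M (\<lambda>\<omega>. \<Phi> (\<lambda>t. X t \<omega>))"
proof -
  interpret prob_space M by (rule M)
  obtain C where C: "\<And>f. continuous_on {0..T} f \<Longrightarrow> \<bar>\<Phi> f\<bar> \<le> C"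
    using assms by (auto simp: bcont_functional_def)
  show ?thesis
    using C X(2) borel_measurable_bcont_functional[OF assms]
    by (intro integrable_const_bound[of _ C]) (auto simp: continuous_process_def)
qed

lemma integral_bernstein_process_tendsto:
  assumes "bcont_functional T \<Phi>"
  shows "(\<lambda>n. \<integral>\<omega>. \<Phi> (bernstein_poly T n (\<lambda>k. X (bernstein_node T n k) \<omega>)) \<partial>M) \<longlonglongrightarrow> (\<integral>\<omega>. \<Phi> (\<lambda>t. X t \<omega>) \<partial>M)"
proof -
  interpret prob_space M by (rule M)
  obtain C where C: "\<And>f. continuous_on {0..T} f \<Longrightarrow> \<bar>\<Phi> f\<bar> \<le> C"
    using assms by (auto simp: bcont_functional_def)
  show ?thesis
    using C continuous_bernstein_poly bernstein_process_tendsto[OF assms]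
    by (intro integral_dominated_convergence[where w="\<lambda>_. C"]
        borel_measurable_bcont_functional[OF assms] borel_measurable_bernstein_process[OF assms]) auto
qed

end

text \<open>A law on the product over the interval is a law on a sigma-algebra where a sup-norm
  continuous functional need not be measurable. Its Bernstein approximations are, so their
  expectations agree, and the limit transfers the equality. This is how (A3) becomes usable for
  \<open>\<Phi>\<close>.\<close>

lemma integral_bcont_functional_eq:
  assumes T: "0 < T" and M: "prob_space M"
    and X: "\<And>t. t \<in> {0..T} \<Longrightarrow> X t \<in> borel_measurable M" "continuous_process T M X"
    and Y: "\<And>t. t \<in> {0..T} \<Longrightarrow> Y t \<in> borel_measurable M" "continuous_process T M Y"
    and law: "distr M (Pi\<^sub>M {0..T} (\<lambda>_. borel)) (\<lambda>\<omega>. restrict (\<lambda>t. X t \<omega>) {0..T})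
      = distr M (Pi\<^sub>M {0..T} (\<lambda>_. borel)) (\<lambda>\<omega>. restrict (\<lambda>t. Y t \<omega>) {0..T})"
    and \<Phi>: "bcont_functional T \<Phi>"
  shows "(\<integral>\<omega>. \<Phi> (\<lambda>t. X t \<omega>) \<partial>M) = (\<integral>\<omega>. \<Phi> (\<lambda>t. Y t \<omega>) \<partial>M)"
proof -
  let ?P = "Pi\<^sub>M {0..T} (\<lambda>_. borel :: real measure)"
  define G where "G n \<rho> = \<Phi> (bernstein_poly T n (\<lambda>k. \<rho> (bernstein_node T n k)))" for n \<rho>
  have mem: "bernstein_node T n k \<in> {0..T}" for n k using T by (intro bernstein_node_mem) simp
  have "(\<lambda>\<rho> k. \<rho> (bernstein_node T n k)) \<in> measurable ?P (Pi\<^sub>M UNIV (\<lambda>_. borel))" for n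
    using mem by (intro measurable_abs_UNIV measurable_component_singleton)
  from measurable_compose[OF this borel_measurable_bernstein_functional[OF T \<Phi>]]
  have G [measurable]: "G n \<in> borel_measurable ?P" for n unfolding G_def .
  have *: "(\<integral>\<omega>. \<Phi> (bernstein_poly T n (\<lambda>k. Z (bernstein_node T n k) \<omega>)) \<partial>M)
      = (\<integral>\<rho>. G n \<rho> \<partial>distr M ?P (\<lambda>\<omega>. restrict (\<lambda>t. Z t \<omega>) {0..T}))"
    if Z: "\<And>t. t \<in> {0..T} \<Longrightarrow> Z t \<in> borel_measurable M" for Z n
  proof -
    have [measurable]: "(\<lambda>\<omega>. restrict (\<lambda>t. Z t \<omega>) {0..T}) \<in> measurable M ?P"
      using Z by (intro measurable_restrict)
    show ?thesis using mem by (subst integral_distr) (auto simp: G_def)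
  qed
  have lim: "(\<lambda>n. \<integral>\<omega>. \<Phi> (bernstein_poly T n (\<lambda>k. Z (bernstein_node T n k) \<omega>)) \<partial>M) \<longlonglongrightarrow> (\<integral>\<omega>. \<Phi> (\<lambda>t. Z t \<omega>) \<partial>M)"
    if "\<And>t. t \<in> {0..T} \<Longrightarrow> Z t \<in> borel_measurable M" "continuous_process T M Z" for Z
    by (rule integral_bernstein_process_tendsto) (use T M \<Phi> that in auto)
  show ?thesis
  proof (rule LIMSEQ_unique)
    show "(\<lambda>n. \<integral>\<rho>. G n \<rho> \<partial>distr M ?P (\<lambda>\<omega>. restrict (\<lambda>t. X t \<omega>) {0..T})) \<longlonglongrightarrow> (\<integral>\<omega>. \<Phi> (\<lambda>t. X t \<omega>) \<partial>M)"
      using lim[of X] X *[of X] by simp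
    show "(\<lambda>n. \<integral>\<rho>. G n \<rho> \<partial>distr M ?P (\<lambda>\<omega>. restrict (\<lambda>t. X t \<omega>) {0..T})) \<longlonglongrightarrow> (\<integral>\<omega>. \<Phi> (\<lambda>t. Y t \<omega>) \<partial>M)"
      using lim[of Y] Y *[of Y] unfolding law by simp
  qed
qed

section \<open>Paths driven away from zero\<close>

locale coefficients =
  fixes T \<kappa> :: real and \<eta> :: "real \<Rightarrow> real"
  assumes T_pos: "0 < T" and cont_\<eta>: "continuous_on {0..T} \<eta>"
begin

abbreviation "w \<equiv> wfun T \<kappa> \<eta>"
abbreviation "k \<equiv> kfun T \<kappa> \<eta>"
text \<open>\<open>g\<close> is the integrand of the noise and \<open>g'\<close> its derivative;
  \<open>v\<close>, the square of \<open>g\<close>, multiplies the control in the drift and is the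
  speed of \<open>k\<close>.\<close>

abbreviation "g \<equiv> \<lambda>t. 1 / wfun T \<kappa> \<eta> t"
abbreviation "v \<equiv> \<lambda>t. 1 / (wfun T \<kappa> \<eta> t)\<^sup>2"
abbreviation "g' \<equiv> \<lambda>t. (\<eta> t - \<kappa>) * g t"

lemma w_pos: "0 < w t"
  by (simp add: wfun_def)

lemma w_has_derivative:
  assumes "t \<in> {0..T}"
  shows "(w has_real_derivative - (\<eta> t - \<kappa>) * w t) (at t within {0..T})"
proof -
  have "continuous_on {0..T} (\<lambda>s. \<eta> s - \<kappa>)" by (intro continuous_intros cont_\<eta>)
  from integral_has_real_derivative'[OF this assms]
  show ?thesis unfolding wfun_def[abs_def] by (auto intro!: derivative_eq_intros)
qed

lemma g_has_derivative:
  assumes "t \<in> {0..T}"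
  shows "(g has_real_derivative g' t) (at t within {0..T})"
  using w_has_derivative[OF assms] w_pos[of t]
  by (auto intro!: derivative_eq_intros simp: field_simps power2_eq_square)

lemma continuous_w: "continuous_on {0..T} w"
  using w_has_derivative by (intro DERIV_continuous_on)

lemma continuous_g: "continuous_on {0..T} g"
  using w_pos by (intro continuous_intros continuous_w) (simp add: less_imp_neq[symmetric])

lemma continuous_v: "continuous_on {0..T} v"
  using w_pos by (intro continuous_intros continuous_w) (simp add: less_imp_neq[symmetric])

lemma continuous_g': "continuous_on {0..T} g'"
  by (intro continuous_intros cont_\<eta> continuous_g)

lemma integrable_sub:
  fixes f :: "real \<Rightarrow> real"
  assumes "continuous_on {0..T} f" "0 \<le> s" "t \<le> T"
  shows "f integrable_on {s..t}"
  using assms by (intro integrable_continuous_real continuous_on_subset[OF assms(1)]) auto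

lemma integral_diff_eq:
  fixes f :: "real \<Rightarrow> real"
  assumes "continuous_on {0..T} f" "0 \<le> s" "s \<le> t" "t \<le> T"
  shows "integral {0..t} f - integral {0..s} f = integral {s..t} f"
  using Henstock_Kurzweil_Integration.integral_combine[of 0 s t f] integrable_sub[of f 0 t] assms by simp

lemma k_diff: "0 \<le> s \<Longrightarrow> s \<le> t \<Longrightarrow> t \<le> T \<Longrightarrow> k t - k s = integral {s..t} v"
  unfolding kfun_def by (rule integral_diff_eq[OF continuous_v])

lemma k_0: "k 0 = 0"
  by (simp add: kfun_def)

lemma continuous_k: "continuous_on {0..T} k"
  unfolding kfun_def by (intro indefinite_integral_continuous_1 integrable_sub continuous_v) auto

text \<open>Both functions integrate \<open>v\<close>, one forward from 0 and the other up to
  \<open>T\<close>, so \<open>rfun\<close> at \<open>s\<close> is \<open>k T - k s\<close>.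
  Thresholds stated through \<open>rfun\<close> can then be compared with the barrier built from
  \<open>k\<close>.\<close>

lemma r_diff:
  assumes "s \<in> {0..T}" "t \<in> {0..T}"
  shows "rfun T \<kappa> \<eta> s - rfun T \<kappa> \<eta> t = k t - k s"
proof -
  have "rfun T \<kappa> \<eta> s = k T - k s" if "s \<in> {0..T}" for s
    unfolding rfun_def using that by (subst k_diff) auto
  then show ?thesis using assms by simp
qed

lemma deriv_g: "t \<in> {0<..<T} \<Longrightarrow> deriv g t = g' t"
  using g_has_derivative[of t] at_within_Icc_at[of 0 t T] by (intro DERIV_imp_deriv) auto

lemma integral_g':
  assumes "0 \<le> s" "s \<le> t" "t \<le> T"
  shows "integral {s..t} g' = g t - g s"
proof -
  have "(g has_vector_derivative g' x) (at x within {s..t})" if "x \<in> {s..t}" for x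
    using DERIV_subset[OF g_has_derivative, of x "{s..t}"] that assms
    by (auto simp: has_real_derivative_iff_has_vector_derivative)
  from fundamental_theorem_of_calculus[OF assms(2) this] show ?thesis by (rule integral_unique)
qed

text \<open>\<open>deriv g\<close> is arbitrary at the end points of \<open>{0..T}\<close>, which the integral does not see.\<close>

lemma wiener_int_increment:
  assumes b: "continuous_on {0..T} (\<lambda>u. B u \<omega>)" and st: "0 \<le> s" "s \<le> t" "t \<le> T"
  shows "wiener_int g B t \<omega> - wiener_int g B s \<omega>
    = g s * (B t \<omega> - B s \<omega>) + integral {s..t} (\<lambda>u. (B t \<omega> - B u \<omega>) * g' u)"
proof -
  have spike: "integral {0..r} (\<lambda>u. B u \<omega> * deriv g u) = integral {0..r} (\<lambda>u. B u \<omega> * g' u)"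
    if "r \<le> T" for r
    using that by (intro integral_spike[of "{0, T}"]) (auto simp: deriv_g)
  have c: "continuous_on {0..T} (\<lambda>u. B u \<omega> * g' u)" by (intro continuous_intros b continuous_g')
  have "integral {s..t} (\<lambda>u. (B t \<omega> - B u \<omega>) * g' u)
      = B t \<omega> * integral {s..t} g' - integral {s..t} (\<lambda>u. B u \<omega> * g' u)"
  proof -
    have "(\<lambda>u. B t \<omega> * g' u) integrable_on {s..t}" "(\<lambda>u. B u \<omega> * g' u) integrable_on {s..t}"
      using st by (intro integrable_sub c continuous_intros continuous_g'; simp)+
    then show ?thesis
      unfolding left_diff_distrib[of "B t \<omega>"] by (simp only: integral_diff integral_mult_right)
  qed
  also have "\<dots> = B t \<omega> * (g t - g s) - (integral {0..t} (\<lambda>u. B u \<omega> * g' u) - integral {0..s} (\<lambda>u. B u \<omega> * g' u))"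
    using integral_g'[OF st] integral_diff_eq[OF c st] by simp
  finally have *: "integral {s..t} (\<lambda>u. (B t \<omega> - B u \<omega>) * g' u)
    = B t \<omega> * (g t - g s) - (integral {0..t} (\<lambda>u. B u \<omega> * g' u) - integral {0..s} (\<lambda>u. B u \<omega> * g' u))" .
  have alg: "(p * x - I) - (q * y - J) = q * (x - y) + (x * (p - q) - (I - J))" for p q x y I J :: real
    by algebra
  show ?thesis
    unfolding wiener_int_def * spike[OF st(3)] spike[OF order_trans[OF st(2,3)]] by (rule alg)
qed

lemma coefficient_bounds:
  obtains gm gM G where "0 < gm" "0 < gM" "0 < G"
    "\<And>t. t \<in> {0..T} \<Longrightarrow> gm \<le> g t" "\<And>t. t \<in> {0..T} \<Longrightarrow> g t \<le> gM" "\<And>t. t \<in> {0..T} \<Longrightarrow> \<bar>g' t\<bar> \<le> G"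
proof -
  have ne: "{0..T} \<noteq> {}" using T_pos by simp
  obtain t1 where t1: "t1 \<in> {0..T}" "\<And>t. t \<in> {0..T} \<Longrightarrow> g t1 \<le> g t"
    using continuous_attains_inf[OF compact_Icc ne continuous_g] by blast
  obtain t2 where t2: "t2 \<in> {0..T}" "\<And>t. t \<in> {0..T} \<Longrightarrow> g t \<le> g t2"
    using continuous_attains_sup[OF compact_Icc ne continuous_g] by blast
  have "continuous_on {0..T} (\<lambda>t. \<bar>g' t\<bar>)" using continuous_g' by (rule continuous_on_rabs)
  from continuous_attains_sup[OF compact_Icc ne this]
  obtain t3 where t3: "t3 \<in> {0..T}" "\<And>t. t \<in> {0..T} \<Longrightarrow> \<bar>g' t\<bar> \<le> \<bar>g' t3\<bar>" by blast
  show ?thesis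
  \<comment> \<open>Adding 1 keeps the last bound positive even if \<open>g'\<close> vanishes
    identically.\<close>
  proof (rule that[of "g t1" "g t2" "\<bar>g' t3\<bar> + 1"])
    show "0 < g t1" "0 < g t2" using w_pos by simp_all
    show "0 < \<bar>g' t3\<bar> + 1" by linarith
    show "\<And>t. t \<in> {0..T} \<Longrightarrow> \<bar>g' t\<bar> \<le> \<bar>g' t3\<bar> + 1" using t3(2) by fastforce
  qed (use t1 t2 in blast)+
qed

end

section \<open>Quantitative bounds and the barrier argument\<close>

text \<open>The bounds are parameters, so that all later estimates are uniform in time, in the
  sample path and in the noise level.\<close>

locale bounded_coefficients = coefficients +
  fixes gm gM G :: real
  assumes gm_pos: "0 < gm" and gM_pos: "0 < gM" and G_pos: "0 < G"
    and gm: "\<And>t. t \<in> {0..T} \<Longrightarrow> gm \<le> g t"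
    and gM: "\<And>t. t \<in> {0..T} \<Longrightarrow> g t \<le> gM"
    and G: "\<And>t. t \<in> {0..T} \<Longrightarrow> \<bar>g' t\<bar> \<le> G"
begin

lemma v_bounds: "t \<in> {0..T} \<Longrightarrow> gm\<^sup>2 \<le> v t" "t \<in> {0..T} \<Longrightarrow> v t \<le> gM\<^sup>2"
proof -
  assume t: "t \<in> {0..T}"
  have "v t = (g t)\<^sup>2" by (simp add: power_one_over)
  then show "gm\<^sup>2 \<le> v t" "v t \<le> gM\<^sup>2"
    using power_mono[OF gm[OF t], of 2] power_mono[OF gM[OF t], of 2] gm_pos w_pos[of t] by auto
qed

lemma k_diff_bounds:
  assumes "0 \<le> s" "s \<le> t" "t \<le> T"
  shows "gm\<^sup>2 * (t - s) \<le> k t - k s" "k t - k s \<le> gM\<^sup>2 * (t - s)"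
proof -
  have i: "v integrable_on {s..t}" using assms by (intro integrable_sub continuous_v) auto
  have "integral {s..t} (\<lambda>_. gm\<^sup>2) \<le> integral {s..t} v" "integral {s..t} v \<le> integral {s..t} (\<lambda>_. gM\<^sup>2)"
    using assms v_bounds by (intro integral_le i; auto)+
  then show "gm\<^sup>2 * (t - s) \<le> k t - k s" "k t - k s \<le> gM\<^sup>2 * (t - s)"
    using assms by (simp_all add: k_diff mult.commute)
qed

lemma k_mono: "0 \<le> s \<Longrightarrow> s \<le> t \<Longrightarrow> t \<le> T \<Longrightarrow> k s \<le> k t"
proof -
  assume st: "0 \<le> s" "s \<le> t" "t \<le> T"
  then have "0 \<le> gm\<^sup>2 * (t - s)" by simp
  with k_diff_bounds(1)[OF st] show ?thesis by linarith
qed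

lemma k_nonneg: "t \<in> {0..T} \<Longrightarrow> 0 \<le> k t"
  using k_mono[of 0 t] k_0 by simp

text \<open>Freezing the integrand at time \<open>s\<close> leaves an integral over
  \<open>{s..t}\<close> whose integrand is at most \<open>2 * R * G\<close>. The noise is thus a
  multiple of a Brownian increment up to an error linear in the elapsed time.\<close>

lemma wiener_int_increment_bound:
  assumes b: "continuous_on {0..T} (\<lambda>u. B u \<omega>)" and st: "0 \<le> s" "s \<le> t" "t \<le> T"
    and R: "\<And>u. u \<in> {0..T} \<Longrightarrow> \<bar>B u \<omega>\<bar> \<le> R"
  shows "\<bar>wiener_int g B t \<omega> - wiener_int g B s \<omega> - g s * (B t \<omega> - B s \<omega>)\<bar> \<le> 2 * R * G * (t - s)"
proof -
  have "norm (integral {s..t} (\<lambda>u. (B t \<omega> - B u \<omega>) * g' u)) \<le> 2 * R * G * (t - s)"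
  proof (rule integral_bound)
    have "continuous_on {0..T} (\<lambda>u. (B t \<omega> - B u \<omega>) * g' u)"
      by (intro continuous_intros b continuous_g')
    then show "continuous_on {s..t} (\<lambda>u. (B t \<omega> - B u \<omega>) * g' u)"
      by (rule continuous_on_subset) (use st in auto)
    fix u assume "u \<in> {s..t}"
    then have u: "u \<in> {0..T}" using st by auto
    have "\<bar>B t \<omega> - B u \<omega>\<bar> \<le> 2 * R" using R[OF u] R[of t] st by simp
    then show "norm ((B t \<omega> - B u \<omega>) * g' u) \<le> 2 * R * G"
      unfolding real_norm_def abs_mult[of _ "g' u"] using G[OF u] by (intro mult_mono) auto
  qed (use st in simp)
  then show ?thesis unfolding wiener_int_increment[of B \<omega>, OF b st] by simp
qed

text \<open>The barrier \<open>b + max 0 (k t - k a)\<close> is never hit: the drift pushes the path away from it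
  at a rate that dominates the noise.\<close>

lemma stays_above:
  fixes m y N :: "real \<Rightarrow> real"
  assumes m: "continuous_on {\<tau>..T} m" and y: "continuous_on {0..T} y" "\<And>t. t \<in> {0..T} \<Longrightarrow> - 1 \<le> y t"
    and \<tau>: "0 \<le> \<tau>" "\<tau> \<le> a" "a \<le> T"
    and eq: "\<And>t. t \<in> {\<tau>..T} \<Longrightarrow> m t - m \<tau> = - integral {\<tau>..t} (\<lambda>s. y s * v s) + (N t - N \<tau>)"
    and drift: "\<And>t. t \<in> {\<tau>..T} \<Longrightarrow> b + max 0 (k t - k a) \<le> m t \<Longrightarrow> y t \<le> - 1 + \<epsilon>"
    and start: "0 < b" "3 * b \<le> m \<tau>"
    and noise: "\<And>t. t \<in> {\<tau>..T} \<Longrightarrow> \<bar>N t - N \<tau>\<bar> \<le> b + gm\<^sup>2 / 4 * (t - \<tau>)"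
      "\<And>t. t \<in> {\<tau>..T} \<Longrightarrow> \<bar>N t - N \<tau>\<bar> \<le> \<nu>"
    and small: "0 \<le> \<epsilon>" "\<epsilon> \<le> 1 / 2" "\<epsilon> * k T + \<nu> + b < k a - k \<tau>"
    and t: "t \<in> {\<tau>..T}"
  shows "\<bar>m t - m \<tau> - (k t - k \<tau>)\<bar> \<le> \<epsilon> * k T + \<nu>"
proof -
  \<comment> \<open>Height of the path above the barrier; the core of the proof is that it stays
    positive.\<close>
  define f where "f t = m t - b - max 0 (k t - k a)" for t
  have ck: "continuous_on {\<tau>..T} k" using \<tau> by (intro continuous_on_subset[OF continuous_k]) auto
  have f: "continuous_on {\<tau>..T} f" unfolding f_def by (intro continuous_intros m ck)
  have gain: "(1 - \<epsilon>) * (k t - k \<tau>) \<le> - integral {\<tau>..t} (\<lambda>s. y s * v s)"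
    if t: "t \<in> {\<tau>..T}" and above: "\<And>s. s \<in> {\<tau>..t} \<Longrightarrow> 0 \<le> f s" for t
  proof -
    have "integral {\<tau>..t} (\<lambda>s. y s * v s) \<le> integral {\<tau>..t} (\<lambda>s. (- 1 + \<epsilon>) * v s)"
    proof (rule integral_le)
      show "(\<lambda>s. y s * v s) integrable_on {\<tau>..t}" "(\<lambda>s. (- 1 + \<epsilon>) * v s) integrable_on {\<tau>..t}"
        using t \<tau> by (intro integrable_sub continuous_on_mult continuous_on_const y(1) continuous_v; simp)+
      fix s assume s: "s \<in> {\<tau>..t}"
      then have "y s \<le> - 1 + \<epsilon>" using drift[of s] above[OF s] t unfolding f_def by simp
      then show "y s * v s \<le> (- 1 + \<epsilon>) * v s" by (rule mult_right_mono) simp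
    qed
    also have "\<dots> = (- 1 + \<epsilon>) * (k t - k \<tau>)"
      using k_diff[of \<tau> t] t \<tau> by (simp only: integral_mult_right) simp
    finally show ?thesis by (simp add: algebra_simps)
  qed
  have kle: "k t - k \<tau> \<le> k T" "0 \<le> k t - k \<tau>" if "t \<in> {\<tau>..T}" for t
    using k_mono[of t T] k_mono[of \<tau> t] k_nonneg[of \<tau>] that \<tau> by auto
  have loss: "k t - k \<tau> - \<epsilon> * k T \<le> (1 - \<epsilon>) * (k t - k \<tau>)" if "t \<in> {\<tau>..T}" for t
    using mult_left_mono[OF kle(1)[OF that] small(1)] by (simp add: algebra_simps)
  have pos: "0 < f t" if "t \<in> {\<tau>..T}" for t
  proof (rule ccontr)
    assume "\<not> 0 < f t"
    define S where "S = {t \<in> {\<tau>..T}. f t \<le> 0}"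
    have "S \<noteq> {}" using \<open>\<not> 0 < f t\<close> that by (auto simp: S_def)
    have "closed S" 
      using continuous_closed_preimage[OF f closed_atLeastAtMost closed_atMost[of 0]]
      by (simp add: S_def vimage_def Int_def)
    have bdd: "bdd_below S" unfolding S_def by (rule bdd_belowI[of _ \<tau>]) auto
    \<comment> \<open>First time at which the barrier is reached. Up to then the drift is under
      control, so \<open>gain\<close> bounds the path from below at \<open>t0\<close>, and a
      contradiction is drawn there.\<close>
    define t0 where "t0 = Inf S"
    have t0: "t0 \<in> S" unfolding t0_def by (rule closed_contains_Inf) fact+
    have "0 < f \<tau>" using start k_mono[of \<tau> a] \<tau> unfolding f_def by simp
    then have "\<tau> < t0" "t0 \<in> {\<tau>..T}" "f t0 \<le> 0"
      using t0 by (auto simp: S_def order.strict_iff_order)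
    have before: "0 \<le> f s" if "s \<in> {\<tau>..<t0}" for s
      using that cInf_lower[OF _ bdd, of s] \<open>t0 \<in> {\<tau>..T}\<close> unfolding t0_def S_def by force
    have above: "0 \<le> f s" if "s \<in> {\<tau>..t0}" for s
      using before that \<open>\<tau> < t0\<close> \<open>t0 \<in> {\<tau>..T}\<close>
      by (intro continuous_ge_on_closure[of "{\<tau>..<t0}" f s 0] continuous_on_subset[OF f]) auto
    note lower = gain[OF \<open>t0 \<in> {\<tau>..T}\<close> above] eq[OF \<open>t0 \<in> {\<tau>..T}\<close>]
    show False
    proof (cases "t0 \<le> a")
      case True
      \<comment> \<open>Flat part of the barrier, at height \<open>b\<close>: the drift gains at
        least \<open>gm\<^sup>2 / 2 * (t0 - \<tau>)\<close>, the noise takes away at most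
        \<open>b + gm\<^sup>2 / 4 * (t0 - \<tau>)\<close>, so a start at \<open>3 * b\<close> leaves
        the path at \<open>2 * b\<close> or more.\<close>
      have d: "0 \<le> t0 - \<tau>" using \<open>\<tau> < t0\<close> by simp
      have "gm\<^sup>2 / 2 * (t0 - \<tau>) \<le> (k t0 - k \<tau>) / 2"
        using k_diff_bounds(1)[of \<tau> t0] \<open>t0 \<in> {\<tau>..T}\<close> \<tau> by simp
      also have "\<dots> \<le> (1 - \<epsilon>) * (k t0 - k \<tau>)"
        using mult_right_mono[of "1 / 2" "1 - \<epsilon>" "k t0 - k \<tau>"] small kle(2)[OF \<open>t0 \<in> {\<tau>..T}\<close>] by simp
      finally have "gm\<^sup>2 / 4 * (t0 - \<tau>) \<le> (1 - \<epsilon>) * (k t0 - k \<tau>)"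
        using mult_nonneg_nonneg[OF zero_le_power2[of gm] d] by simp
      moreover have "k t0 - k a \<le> 0" using k_mono[of t0 a] True \<open>t0 \<in> {\<tau>..T}\<close> \<tau> by simp
      ultimately show False
        using noise(1)[OF \<open>t0 \<in> {\<tau>..T}\<close>] lower start \<open>f t0 \<le> 0\<close> unfolding f_def by linarith
    next
      case False
      \<comment> \<open>Rising part: the barrier grows as fast as the ideal path, but started to
        rise later. The head start \<open>k a - k \<tau>\<close> absorbs the uniform noise bound
        \<open>\<nu>\<close> and the drift error.\<close>
      then have "0 \<le> k t0 - k a" using k_mono[of a t0] \<open>t0 \<in> {\<tau>..T}\<close> \<tau> by simp
      then show False
        using noise(2)[OF \<open>t0 \<in> {\<tau>..T}\<close>] lower start \<open>f t0 \<le> 0\<close> loss[OF \<open>t0 \<in> {\<tau>..T}\<close>] small(3)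
        unfolding f_def by linarith
    qed
  qed
  have upper: "- integral {\<tau>..t} (\<lambda>s. y s * v s) \<le> k t - k \<tau>"
  proof -
    have "integral {\<tau>..t} (\<lambda>s. (- 1) * v s) \<le> integral {\<tau>..t} (\<lambda>s. y s * v s)"
    proof (rule integral_le)
      show "(\<lambda>s. y s * v s) integrable_on {\<tau>..t}" "(\<lambda>s. (- 1) * v s) integrable_on {\<tau>..t}"
        using t \<tau> by (intro integrable_sub continuous_on_mult continuous_on_const y(1) continuous_v; simp)+
      fix s assume "s \<in> {\<tau>..t}"
      then show "(- 1) * v s \<le> y s * v s" using y(2)[of s] t \<tau> by (intro mult_right_mono) auto
    qed
    then show ?thesis using k_diff[of \<tau> t] t \<tau> by simp
  qed
  have "(1 - \<epsilon>) * (k t - k \<tau>) \<le> - integral {\<tau>..t} (\<lambda>s. y s * v s)"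
    using t pos by (intro gain) (auto intro: less_imp_le)
  then show ?thesis
    using upper loss[OF t] eq[OF t] noise(2)[OF t] mult_nonneg_nonneg[OF small(1), of "k T"] k_nonneg[of T] T_pos
    by auto
qed

end

section \<open>Deterministic analysis of a single sample path\<close>

locale controlled_path = bounded_coefficients T \<kappa> \<eta> gm gM G
  for T \<kappa> \<eta> gm gM G +
  fixes \<sigma> R :: real and B :: "real \<Rightarrow> 'a \<Rightarrow> real" and \<omega> :: 'a and m y :: "real \<Rightarrow> real"
  assumes \<sigma>_pos: "0 < \<sigma>"
    and cont_B: "continuous_on {0..T} (\<lambda>t. B t \<omega>)" and B_start: "B 0 \<omega> = 0"
    and B_bound: "\<And>t. t \<in> {0..T} \<Longrightarrow> \<bar>B t \<omega>\<bar> \<le> R"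
    and cont_m: "continuous_on {0..T} m" and cont_y: "continuous_on {0..T} y"
    and y_bound: "\<And>t. t \<in> {0..T} \<Longrightarrow> \<bar>y t\<bar> \<le> 1"
    and m_eq: "\<And>t. t \<in> {0..T} \<Longrightarrow>
      m t = - integral {0..t} (\<lambda>s. y s / (w s)\<^sup>2) + \<sigma> * wiener_int g B t \<omega>"
begin

abbreviation "N t \<equiv> \<sigma> * wiener_int g B t \<omega>"
definition "\<nu> = 2 * \<sigma> * R * (gM + G * T)"

lemma R_nonneg: "0 \<le> R"
  using B_bound[of 0] T_pos by auto

lemma noise_increment:
  assumes "0 \<le> s" "s \<le> t" "t \<le> T"
  shows "\<bar>N t - N s - \<sigma> * (g s * (B t \<omega> - B s \<omega>))\<bar> \<le> 2 * \<sigma> * R * G * (t - s)"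
proof -
  have "N t - N s - \<sigma> * (g s * (B t \<omega> - B s \<omega>))
      = \<sigma> * (wiener_int g B t \<omega> - wiener_int g B s \<omega> - g s * (B t \<omega> - B s \<omega>))"
    by (simp only: right_diff_distrib)
  also have "\<bar>\<dots>\<bar> \<le> \<sigma> * (2 * R * G * (t - s))"
    unfolding abs_mult abs_of_pos[OF \<sigma>_pos]
    using wiener_int_increment_bound[of B \<omega> s t R, OF cont_B assms B_bound] \<sigma>_pos by (intro mult_left_mono) auto
  finally show ?thesis by (simp add: mult_ac)
qed

lemma noise_upper:
  assumes "0 \<le> s" "s \<le> t" "t \<le> T"
  shows "\<bar>N t - N s\<bar> \<le> \<sigma> * gM * \<bar>B t \<omega> - B s \<omega>\<bar> + 2 * \<sigma> * R * G * (t - s)"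
proof -
  have "\<bar>\<sigma> * (g s * (B t \<omega> - B s \<omega>))\<bar> = \<sigma> * g s * \<bar>B t \<omega> - B s \<omega>\<bar>"
    using \<sigma>_pos w_pos[of s] by (simp add: abs_mult)
  also have "\<dots> \<le> \<sigma> * gM * \<bar>B t \<omega> - B s \<omega>\<bar>"
    using gM[of s] assms \<sigma>_pos by (intro mult_right_mono mult_left_mono) auto
  finally show ?thesis using noise_increment[OF assms] by linarith
qed

lemma noise_lower:
  assumes "0 \<le> s" "s \<le> t" "t \<le> T"
  shows "\<sigma> * gm * \<bar>B t \<omega> - B s \<omega>\<bar> \<le> \<bar>N t - N s\<bar> + 2 * \<sigma> * R * G * (t - s)"
proof -
  have "\<sigma> * gm * \<bar>B t \<omega> - B s \<omega>\<bar> \<le> \<sigma> * g s * \<bar>B t \<omega> - B s \<omega>\<bar>"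
    using gm[of s] assms \<sigma>_pos by (intro mult_right_mono mult_left_mono) auto
  also have "\<dots> = \<bar>\<sigma> * (g s * (B t \<omega> - B s \<omega>))\<bar>"
    using \<sigma>_pos w_pos[of s] by (simp add: abs_mult)
  finally show ?thesis using noise_increment[OF assms] by linarith
qed

lemma noise_le_\<nu>:
  assumes "0 \<le> s" "s \<le> t" "t \<le> T"
  shows "\<bar>N t - N s\<bar> \<le> \<nu>"
proof -
  have "\<bar>B t \<omega> - B s \<omega>\<bar> \<le> 2 * R" using B_bound[of s] B_bound[of t] assms by auto
  then have "\<sigma> * gM * \<bar>B t \<omega> - B s \<omega>\<bar> \<le> \<sigma> * gM * (2 * R)"
    using \<sigma>_pos gM_pos by (intro mult_left_mono) auto
  moreover have "2 * \<sigma> * R * G * (t - s) \<le> 2 * \<sigma> * R * G * T"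
    using \<sigma>_pos R_nonneg G_pos assms by (intro mult_left_mono) auto
  ultimately show ?thesis using noise_upper[OF assms] by (simp add: \<nu>_def algebra_simps)
qed

lemma continuous_yv: "continuous_on {0..T} (\<lambda>s. y s * v s)"
  by (intro continuous_on_mult cont_y continuous_v)

lemma m_increment:
  assumes "0 \<le> s" "s \<le> t" "t \<le> T"
  shows "m t - m s = - integral {s..t} (\<lambda>s. y s * v s) + (N t - N s)"
  using m_eq[of s] m_eq[of t] integral_diff_eq[OF continuous_yv assms] assms by simp

text \<open>A control of size at most 1 moves the path at speed at most \<open>gM\<^sup>2\<close>.
  Path and noise increments therefore control each other in both directions.\<close>

lemma m_increment_bound:
  assumes "0 \<le> s" "s \<le> t" "t \<le> T"
  shows "\<bar>m t - m s\<bar> \<le> gM\<^sup>2 * (t - s) + \<bar>N t - N s\<bar>" "\<bar>N t - N s\<bar> \<le> gM\<^sup>2 * (t - s) + \<bar>m t - m s\<bar>"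
proof -
  have "norm (integral {s..t} (\<lambda>s. y s * v s)) \<le> gM\<^sup>2 * (t - s)"
  proof (rule integral_bound)
    show "continuous_on {s..t} (\<lambda>s. y s * v s)"
      by (rule continuous_on_subset[OF continuous_yv]) (use assms in auto)
    fix r assume r: "r \<in> {s..t}"
    have "\<bar>y r\<bar> * v r \<le> 1 * gM\<^sup>2"
      using y_bound[of r] v_bounds(2)[of r] r assms by (intro mult_mono) auto
    then show "norm (y r * v r) \<le> gM\<^sup>2" by (simp add: abs_mult)
  qed (use assms in simp)
  then show "\<bar>m t - m s\<bar> \<le> gM\<^sup>2 * (t - s) + \<bar>N t - N s\<bar>" "\<bar>N t - N s\<bar> \<le> gM\<^sup>2 * (t - s) + \<bar>m t - m s\<bar>"
    using m_increment[OF assms] by auto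
qed

text \<open>Read contrapositively: a large Brownian increment forces the path out of the band of
  width \<open>2 * c\<close> at one of the two times, whatever the drift does inside the
  band.\<close>

lemma increment_escape:
  assumes "0 \<le> s" "s \<le> t" "t \<le> T" and "\<bar>m s\<bar> < c" "\<bar>m t\<bar> < c"
  shows "\<sigma> * gm * \<bar>B t \<omega> - B s \<omega>\<bar> < 2 * c + (gM\<^sup>2 + 2 * \<sigma> * R * G) * (t - s)"
  using noise_lower[OF assms(1-3)] m_increment_bound(2)[OF assms(1-3)] assms(4,5)
  by (simp add: distrib_right)

text \<open>Multiplying the path by its sign at \<open>\<tau>\<close> reduces to a start above the
  barrier, and \<open>stays_above\<close> applies from \<open>\<tau>\<close> on. Before
  \<open>\<tau>\<close> both the path and \<open>k\<close> are small; the value of each at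
  \<open>\<tau>\<close> enters the final error, whence the doubled terms.\<close>

lemma close_to_extremal:
  assumes drift: "\<And>t. t \<in> {0..T} \<Longrightarrow> b + max 0 (k t - k a) \<le> \<bar>m t\<bar> \<Longrightarrow> \<bar>y t + sgn (m t)\<bar> \<le> \<epsilon>"
    and \<tau>: "0 \<le> \<tau>" "\<tau> \<le> a" "a \<le> T" and start: "0 < b" "3 * b \<le> \<bar>m \<tau>\<bar>"
    and inc: "\<And>t. t \<in> {\<tau>..T} \<Longrightarrow> \<bar>B t \<omega> - B \<tau> \<omega>\<bar> \<le> c + l / 2 * (t - \<tau>)"
    and const: "\<sigma> * gM * c \<le> b" "\<sigma> * gM * l \<le> gm\<^sup>2 / 4" "2 * \<sigma> * R * G \<le> gm\<^sup>2 / 8"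
    and small: "0 \<le> \<epsilon>" "\<epsilon> \<le> 1 / 2" "\<epsilon> * k T + \<nu> + b + gM\<^sup>2 * \<tau> < gm\<^sup>2 * a"
  shows "\<exists>s\<in>{1, - 1}. \<forall>t\<in>{0..T}. \<bar>m t - s * k t\<bar> \<le> 2 * gM\<^sup>2 * \<tau> + 2 * \<nu> + \<epsilon> * k T"
proof -
  define s where "s = sgn (m \<tau>)"
  have "m \<tau> \<noteq> 0" using start by auto
  then have s: "s \<in> {1, - 1}" "s * m \<tau> = \<bar>m \<tau>\<bar>" "\<bar>s\<bar> = 1"
    by (auto simp: s_def sgn_if)
  have abs_s: "\<bar>s * x\<bar> = \<bar>x\<bar>" for x using s(3) by (simp add: abs_mult)
  \<comment> \<open>The offset \<open>c\<close> is absorbed in \<open>b\<close>. The slope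
    \<open>l / 2\<close> and the remainder of the Wiener integral contribute
    \<open>gm\<^sup>2 / 8\<close> each, which makes up the slope allowed by
    \<open>stays_above\<close>.\<close>
  have noise: "\<bar>N t - N \<tau>\<bar> \<le> b + gm\<^sup>2 / 4 * (t - \<tau>)" if t: "t \<in> {\<tau>..T}" for t
  proof -
    have "\<sigma> * gM * \<bar>B t \<omega> - B \<tau> \<omega>\<bar> \<le> \<sigma> * gM * (c + l / 2 * (t - \<tau>))"
      using inc[OF t] \<sigma>_pos gM_pos by (intro mult_left_mono) auto
    also have "\<dots> = \<sigma> * gM * c + (\<sigma> * gM * l) * ((t - \<tau>) / 2)" by (simp add: algebra_simps)
    also have "\<dots> \<le> b + gm\<^sup>2 / 4 * ((t - \<tau>) / 2)"
      using const t by (intro add_mono mult_right_mono) auto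
    finally have "\<sigma> * gM * \<bar>B t \<omega> - B \<tau> \<omega>\<bar> \<le> b + gm\<^sup>2 / 8 * (t - \<tau>)" by simp
    moreover have "2 * \<sigma> * R * G * (t - \<tau>) \<le> gm\<^sup>2 / 8 * (t - \<tau>)"
      using const(3) t by (intro mult_right_mono) auto
    moreover have "\<bar>N t - N \<tau>\<bar> \<le> \<sigma> * gM * \<bar>B t \<omega> - B \<tau> \<omega>\<bar> + 2 * \<sigma> * R * G * (t - \<tau>)"
      using t \<tau> by (intro noise_upper) auto
    ultimately show ?thesis by linarith
  qed
  have k\<tau>: "0 \<le> k \<tau>" "k \<tau> \<le> gM\<^sup>2 * \<tau>"
    using k_nonneg[of \<tau>] k_diff_bounds(2)[of 0 \<tau>] k_0 \<tau> by auto
  have ka: "gm\<^sup>2 * a \<le> k a" using k_diff_bounds(1)[of 0 a] k_0 \<tau> by auto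
  have after: "\<bar>s * m t - s * m \<tau> - (k t - k \<tau>)\<bar> \<le> \<epsilon> * k T + \<nu>" if t: "t \<in> {\<tau>..T}" for t
  proof (rule stays_above[where N = "\<lambda>t. s * N t" and y = "\<lambda>t. s * y t" and a = a and b = b])
    show "continuous_on {\<tau>..T} (\<lambda>t. s * m t)"
      by (intro continuous_intros continuous_on_subset[OF cont_m]) (use \<tau> in auto)
    show "continuous_on {0..T} (\<lambda>t. s * y t)" by (intro continuous_intros cont_y)
    show "- 1 \<le> s * y t" if "t \<in> {0..T}" for t
      using y_bound[OF that] abs_s[of "y t"] by linarith
    show "s * m t - s * m \<tau> = - integral {\<tau>..t} (\<lambda>r. s * y r * v r) + (s * N t - s * N \<tau>)"
      if "t \<in> {\<tau>..T}" for t
    proof -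
      have "integral {\<tau>..t} (\<lambda>r. s * y r * v r) = s * integral {\<tau>..t} (\<lambda>r. y r * v r)"
        unfolding mult.assoc by (rule integral_mult_right)
      moreover have "m t - m \<tau> = - integral {\<tau>..t} (\<lambda>r. y r * v r) + (N t - N \<tau>)"
        using that \<tau> by (intro m_increment) auto
      moreover have "s * x - s * x' = - (s * J) + (s * p - s * q)" if "x - x' = - J + (p - q)" for x x' J p q :: real
        using that by algebra
      ultimately show ?thesis by presburger
    qed
    show "s * y t \<le> - 1 + \<epsilon>" if t: "t \<in> {\<tau>..T}" and above: "b + max 0 (k t - k a) \<le> s * m t" for t
    proof -
      have "0 < s * m t" using above start by simp
      then have "sgn (m t) = s" "\<bar>m t\<bar> = s * m t" using s(1) by (auto simp: sgn_if)
      then have "\<bar>y t + s\<bar> \<le> \<epsilon>" using drift[of t] above t \<tau> by simp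
      then show ?thesis using s(1) by auto
    qed
    show "\<bar>s * N t - s * N \<tau>\<bar> \<le> b + gm\<^sup>2 / 4 * (t - \<tau>)" if "t \<in> {\<tau>..T}" for t
      using noise[OF that] by (simp only: abs_s flip: right_diff_distrib)
    show "\<bar>s * N t - s * N \<tau>\<bar> \<le> \<nu>" if "t \<in> {\<tau>..T}" for t
      using noise_le_\<nu>[of \<tau> t] that \<tau> by (simp only: abs_s atLeastAtMost_iff flip: right_diff_distrib)
    show "\<epsilon> * k T + \<nu> + b < k a - k \<tau>" using small(3) k\<tau> ka by linarith
  qed (use \<tau> start s small t in auto)
  have N0: "N 0 = 0" "m 0 = 0" using m_eq[of 0] T_pos by (auto simp: wiener_int_def B_start)
  have before: "\<bar>m t\<bar> \<le> gM\<^sup>2 * \<tau> + \<nu>" "k t \<le> gM\<^sup>2 * \<tau>" if t: "0 \<le> t" "t \<le> \<tau>" for t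
  proof -
    have le: "gM\<^sup>2 * t \<le> gM\<^sup>2 * \<tau>" using t by (intro mult_left_mono) auto
    show "\<bar>m t\<bar> \<le> gM\<^sup>2 * \<tau> + \<nu>"
      using m_increment_bound(1)[of 0 t] noise_le_\<nu>[of 0 t] N0 t \<tau> le by simp
    show "k t \<le> gM\<^sup>2 * \<tau>" using k_diff_bounds(2)[of 0 t] k_0 t \<tau> le by simp
  qed
  have nonneg: "0 \<le> \<epsilon> * k T" "0 \<le> \<nu>" "0 \<le> gM\<^sup>2 * \<tau>"
    using small(1) k_nonneg[of T] T_pos noise_le_\<nu>[of 0 0] \<tau> by auto
  have "\<bar>m t - s * k t\<bar> \<le> 2 * gM\<^sup>2 * \<tau> + 2 * \<nu> + \<epsilon> * k T" if t: "t \<in> {0..T}" for t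
  proof -
    have "\<bar>m t - s * k t\<bar> = \<bar>s * m t - k t\<bar>"
      using s(1) by auto
    also have "\<dots> \<le> 2 * gM\<^sup>2 * \<tau> + 2 * \<nu> + \<epsilon> * k T"
    proof (cases "t \<le> \<tau>")
      case True
      then have "\<bar>m t\<bar> \<le> gM\<^sup>2 * \<tau> + \<nu>" "k t \<le> gM\<^sup>2 * \<tau>" using before t by auto
      then show ?thesis
        using nonneg k_nonneg[OF t] abs_s[of "m t"] by linarith
    next
      case False
      then have "\<bar>s * m t - s * m \<tau> - (k t - k \<tau>)\<bar> \<le> \<epsilon> * k T + \<nu>" using after t by auto
      moreover have "\<bar>m \<tau>\<bar> \<le> gM\<^sup>2 * \<tau> + \<nu>" using before \<tau> by auto
      ultimately show ?thesis
        using abs_s[of "m \<tau>"] nonneg k\<tau> by linarith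
    qed
    finally show ?thesis .
  qed
  then show ?thesis using s(1) by blast
qed

end


section \<open>The exceptional event and its probability\<close>

locale driven_coefficients = bounded_coefficients T \<kappa> \<eta> gm gM G + bm T M F B
  for T \<kappa> \<eta> gm gM G and M :: "'a measure" and F B
begin

text \<open>Four things can go wrong: the Brownian path leaves \<open>{- R..R}\<close>, the
  perturbation \<open>\<Delta>\<close> exceeds \<open>\<epsilon>\<close>, no increment among the
  first \<open>n\<close> steps is large, or the noise is too strong after the exit. Each has one
  term in the bound, and otherwise the analysis of a single path applies, with drift error
  \<open>2 * \<epsilon>\<close> because the errors of \<open>\<theta>\<close> and
  \<open>\<Delta>\<close> add up.\<close>

lemma exceptional_event:
  fixes \<mu> Y \<Delta> :: "real \<Rightarrow> 'a \<Rightarrow> real" and \<theta> :: "real \<Rightarrow> real \<Rightarrow> real"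
  assumes \<sigma>: "0 < \<sigma>"
    and \<mu>: "adapted_on T F \<mu>" "continuous_process T M \<mu>"
    and Y: "continuous_process T M Y" "\<And>\<omega> t. \<omega> \<in> space M \<Longrightarrow> t \<in> {0..T} \<Longrightarrow> \<bar>Y t \<omega>\<bar> \<le> 1"
    and \<Delta>: "adapted_on T F \<Delta>" "continuous_process T M \<Delta>"
    and eq: "AE \<omega> in M. \<forall>t\<in>{0..T}.
        \<mu> t \<omega> = - integral {0..t} (\<lambda>s. Y s \<omega> / (w s)\<^sup>2) + \<sigma> * wiener_int g B t \<omega>
        \<and> Y t \<omega> = \<theta> t (\<mu> t \<omega>) - \<Delta> t \<omega>"
    and \<theta>: "\<And>t x. t \<in> {0..T} \<Longrightarrow> b + max 0 (k t - k a) \<le> \<bar>x\<bar> \<Longrightarrow> \<bar>\<theta> t x + sgn x\<bar> \<le> \<epsilon>"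
    and b: "0 < b" "real n * b \<le> a" "a \<le> T" and z: "0 \<le> z" and l: "0 < l"
    and jump: "6 * b + (gM\<^sup>2 + 2 * \<sigma> * R * G) * b \<le> \<sigma> * gm * (z * sqrt b)"
    and const: "\<sigma> * gM * (\<beta> / l) \<le> b" "\<sigma> * gM * l \<le> gm\<^sup>2 / 4" "2 * \<sigma> * R * G \<le> gm\<^sup>2 / 8"
    and small: "0 \<le> \<epsilon>" "2 * \<epsilon> \<le> 1 / 2"
      "2 * \<epsilon> * k T + 2 * \<sigma> * R * (gM + G * T) + b + gM\<^sup>2 * (real n * b) < gm\<^sup>2 * a"
  shows "\<exists>E\<in>sets M.
    (AE \<omega> in M. \<omega> \<notin> E \<longrightarrow> (\<exists>s\<in>{1, - 1}. \<forall>t\<in>{0..T}. \<bar>\<mu> t \<omega> - s * k t\<bar>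
        \<le> 2 * gM\<^sup>2 * (real n * b) + 2 * (2 * \<sigma> * R * (gM + G * T)) + 2 * \<epsilon> * k T)) \<and>
    measure M E \<le> 2 * exp (T / 2 - R) + measure M {\<omega>\<in>space M. (SUP t\<in>{0..T}. \<bar>\<Delta> t \<omega>\<bar>) > \<epsilon>}
      + (1 - exp (- (z + 1)\<^sup>2 / 2) / sqrt (2 * pi)) ^ n + 2 * exp (- \<beta>)"
proof -
  define \<tau> where "\<tau> i = real i * b" for i
  have \<tau>: "\<tau> i \<in> {0..T}" "\<tau> i \<le> a" "\<tau> i \<le> real n * b" if "i \<le> n" for i
  proof -
    show le: "\<tau> i \<le> real n * b" using that b unfolding \<tau>_def by (intro mult_right_mono) auto
    have "0 \<le> \<tau> i" using b by (simp add: \<tau>_def)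
    with le b show "\<tau> i \<in> {0..T}" "\<tau> i \<le> a" by auto
  qed
  have \<tau>_mono: "\<tau> i \<le> \<tau> j" if "i \<le> j" for i j
    using that b unfolding \<tau>_def by (intro mult_right_mono) auto
  have zero: "0 \<in> {0..T}" using T_pos by simp

  \<comment> \<open>The maximal inequality with \<open>l = 1\<close> and level
    \<open>R - T / 2\<close>: the resulting line stays below \<open>R\<close> up to time
    \<open>T\<close>.\<close>
  define E1 where "E1 = {\<omega>\<in>space M. \<exists>t\<in>{0..T}. (R - T / 2) / 1 + 1 / 2 * (t - 0) < \<bar>B t \<omega> - B 0 \<omega>\<bar>}"
  have "space M \<in> sets (F 0)" using space_F[OF zero] sets.top[of "F 0"] by simp
  from exponential_maximal_abs[OF zero this, of 1 "R - T / 2"]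
  have E1: "E1 \<in> sets M" "measure M E1 \<le> 2 * exp (T / 2 - R)"
    by (simp_all add: E1_def prob_space Int_absorb1[OF Collect_restrict])

  define E2 where "E2 = {\<omega>\<in>space M. (SUP t\<in>{0..T}. \<bar>\<Delta> t \<omega>\<bar>) > \<epsilon>}"
  have \<Delta>c: "continuous_on {0..T} (\<lambda>t. \<bar>\<Delta> t \<omega>\<bar>)" if "\<omega> \<in> space M" for \<omega>
    using \<Delta>(2) that unfolding continuous_process_def by (intro continuous_on_rabs) auto
  have \<Delta>bdd: "bdd_above ((\<lambda>t. \<bar>\<Delta> t \<omega>\<bar>) ` {0..T})" if "\<omega> \<in> space M" for \<omega>
    using compact_continuous_image[OF \<Delta>c[OF that] compact_Icc] by (intro bounded_imp_bdd_above compact_imp_bounded)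
  \<comment> \<open>By continuity the supremum is over a bounded set, so it exceeds
    \<open>\<epsilon>\<close> exactly when some value does; this form is measurable by the dyadic
    argument.\<close>
  have E2_eq: "E2 = {\<omega>\<in>space M. \<exists>t\<in>{0..T}. \<epsilon> < \<bar>\<Delta> t \<omega>\<bar>}"
    unfolding E2_def using \<Delta>bdd zero by (intro Collect_cong conj_cong refl less_cSUP_iff) auto
  have E2: "E2 \<in> sets M"
    unfolding E2_eq using T_pos adapted_M[OF \<Delta>(1)] \<Delta>c
    by (intro exceed_in_sets borel_measurable_abs) auto

  define E3 where "E3 = {\<omega>\<in>space M. \<forall>i<n. B (real (Suc i) * b) \<omega> - B (real i * b) \<omega> < z * sqrt b}"
  have E3: "E3 \<in> sets M" "measure M E3 \<le> (1 - exp (- (z + 1)\<^sup>2 / 2) / sqrt (2 * pi)) ^ n"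
    unfolding E3_def using b by (intro no_large_increment z; simp)+

  \<comment> \<open>On \<open>D i\<close> the first grid exit from the band happens at index
    \<open>i\<close>; on \<open>A i\<close> the noise from then on crosses the line. Splitting by
    the value of the exit time lets the maximal inequality be used at fixed times only.\<close>
  define D where "D i = {\<omega>\<in>space M. (\<forall>j<i. \<bar>\<mu> (\<tau> j) \<omega>\<bar> < 3 * b) \<and> 3 * b \<le> \<bar>\<mu> (\<tau> i) \<omega>\<bar>}" for i
  define A where "A i = {\<omega>\<in>space M. \<exists>t\<in>{\<tau> i..T}. \<beta> / l + l / 2 * (t - \<tau> i) < \<bar>B t \<omega> - B (\<tau> i) \<omega>\<bar>}" for i
  define E4 where "E4 = (\<Union>i\<le>n. D i \<inter> A i)"
  have DF: "D i \<in> sets (F (\<tau> i))" if i: "i \<le> n" for i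
  proof -
    have [measurable]: "\<mu> (\<tau> j) \<in> borel_measurable (F (\<tau> i))" if "j \<le> i" for j
      using that i \<tau>_mono[OF that] by (intro adapted_mono[OF \<mu>(1)] \<tau>) auto
    have "{\<omega>\<in>space (F (\<tau> i)). (\<forall>j\<in>{..<i}. \<bar>\<mu> (\<tau> j) \<omega>\<bar> < 3 * b) \<and> 3 * b \<le> \<bar>\<mu> (\<tau> i) \<omega>\<bar>} \<in> sets (F (\<tau> i))"
      by (intro sets.sets_Collect_conj sets.sets_Collect_finite_All) (measurable; simp)+
    then show ?thesis unfolding D_def space_F[OF \<tau>(1)[OF i]] Ball_def lessThan_iff .
  qed
  have A: "A i \<in> sets M" "measure M (D i \<inter> A i) \<le> 2 * exp (- \<beta>) * measure M (D i)" if "i \<le> n" for i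
    unfolding A_def by (rule exponential_maximal_abs[OF \<tau>(1)[OF that] DF[OF that] l])+
  have DM: "D i \<in> sets M" if "i \<le> n" for i using sets_F_le[OF \<tau>(1) DF] that by blast
  \<comment> \<open>Each piece is bounded by a multiple of the probability of \<open>D i\<close>.
    These events are disjoint, so the sum over \<open>i\<close> costs no factor depending on
    \<open>n\<close>.\<close>
  have E4: "E4 \<in> sets M" "measure M E4 \<le> 2 * exp (- \<beta>)"
  proof -
    show "E4 \<in> sets M" unfolding E4_def using A(1) DM by auto
    have "disjoint_family_on D {..n}"
      unfolding disjoint_family_on_def
    proof (intro ballI impI)
      fix i j :: nat assume "i \<noteq> j"
      then consider "i < j" | "j < i" by linarith
      then show "D i \<inter> D j = {}" by cases (auto simp: D_def not_less[symmetric])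
    qed
    then have "(\<Sum>i\<le>n. measure M (D i)) = measure M (\<Union>i\<le>n. D i)"
      using DM by (intro finite_measure_finite_Union[symmetric]) auto
    also have "\<dots> \<le> 1" by (rule prob_le_1)
    finally have sum: "(\<Sum>i\<le>n. measure M (D i)) \<le> 1" .
    have "measure M E4 \<le> (\<Sum>i\<le>n. measure M (D i \<inter> A i))"
      unfolding E4_def using A(1) DM by (intro finite_measure_subadditive_finite) auto
    also have "\<dots> \<le> (\<Sum>i\<le>n. 2 * exp (- \<beta>) * measure M (D i))"
      using A(2) by (intro sum_mono) auto
    also have "\<dots> \<le> 2 * exp (- \<beta>)"
      unfolding sum_distrib_left[symmetric] using mult_left_mono[OF sum, of "2 * exp (- \<beta>)"] by simp
    finally show "measure M E4 \<le> 2 * exp (- \<beta>)" .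
  qed

  define E where "E = E1 \<union> E2 \<union> E3 \<union> E4"
  have EM: "E \<in> sets M" unfolding E_def using E1 E2 E3 E4 by auto
  have "measure M E \<le> measure M E1 + measure M E2 + measure M E3 + measure M E4"
    unfolding E_def using E1(1) E2 E3(1) E4(1)
    by (intro order_trans[OF measure_Un_le] add_mono order_refl) auto
  also have "\<dots> \<le> 2 * exp (T / 2 - R) + measure M E2
      + (1 - exp (- (z + 1)\<^sup>2 / 2) / sqrt (2 * pi)) ^ n + 2 * exp (- \<beta>)"
    using E1(2) E3(2) E4(2) by simp
  finally have PE: "measure M E \<le> 2 * exp (T / 2 - R) + measure M E2
      + (1 - exp (- (z + 1)\<^sup>2 / 2) / sqrt (2 * pi)) ^ n + 2 * exp (- \<beta>)" .

  have "AE \<omega> in M. \<omega> \<notin> E \<longrightarrow> (\<exists>s\<in>{1, - 1}. \<forall>t\<in>{0..T}. \<bar>\<mu> t \<omega> - s * k t\<bar>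
        \<le> 2 * gM\<^sup>2 * (real n * b) + 2 * (2 * \<sigma> * R * (gM + G * T)) + 2 * \<epsilon> * k T)"
    using eq AE_space
  proof eventually_elim
    case (elim \<omega>)
    then have \<omega>: "\<omega> \<in> space M" by simp
    show ?case
    proof
      assume "\<omega> \<notin> E"
      then have nE: "\<omega> \<notin> E1" "\<omega> \<notin> E2" "\<omega> \<notin> E3" "\<omega> \<notin> E4" by (auto simp: E_def)
      interpret controlled_path T \<kappa> \<eta> gm gM G \<sigma> R B \<omega> "\<lambda>t. \<mu> t \<omega>" "\<lambda>t. Y t \<omega>"
      proof
        fix t assume t: "t \<in> {0..T}"
        have "\<bar>B t \<omega>\<bar> \<le> (R - T / 2) + 1 / 2 * t"
          using nE(1) t \<omega> B_0[OF \<omega>] unfolding E1_def by (auto simp: not_less)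
        then show "\<bar>B t \<omega>\<bar> \<le> R" using t by auto
        show "\<bar>Y t \<omega>\<bar> \<le> 1" using Y(2)[OF \<omega> t] .
        show "\<mu> t \<omega> = - integral {0..t} (\<lambda>s. Y s \<omega> / (w s)\<^sup>2) + \<sigma> * wiener_int g B t \<omega>"
          using elim t by blast
      qed (use \<sigma> B_cont B_0 \<mu>(2) Y(1) \<omega> in \<open>auto simp: continuous_process_def\<close>)
      have drift: "\<bar>Y t \<omega> + sgn (\<mu> t \<omega>)\<bar> \<le> 2 * \<epsilon>"
        if t: "t \<in> {0..T}" "b + max 0 (k t - k a) \<le> \<bar>\<mu> t \<omega>\<bar>" for t
      proof -
        have "\<bar>\<Delta> t \<omega>\<bar> \<le> \<epsilon>" using nE(2) \<omega> t(1) unfolding E2_eq by (auto simp: not_less)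
        then show ?thesis using \<theta>[OF t] elim t(1) by auto
      qed
      \<comment> \<open>If all grid values stayed in the band, the large increment that exists off
        \<open>E3\<close> would contradict \<open>increment_escape\<close> through
        \<open>jump\<close>.\<close>
      have "\<exists>j\<le>n. 3 * b \<le> \<bar>\<mu> (\<tau> j) \<omega>\<bar>"
      proof (rule ccontr)
        assume "\<not> ?thesis"
        then have less: "\<bar>\<mu> (\<tau> j) \<omega>\<bar> < 3 * b" if "j \<le> n" for j using that by force
        obtain i where i: "i < n" "z * sqrt b \<le> B (\<tau> (Suc i)) \<omega> - B (\<tau> i) \<omega>"
          using nE(3) \<omega> unfolding E3_def \<tau>_def by (auto simp: not_less)
        have d: "\<tau> (Suc i) - \<tau> i = b" by (simp add: \<tau>_def algebra_simps)
        have "\<sigma> * gm * \<bar>B (\<tau> (Suc i)) \<omega> - B (\<tau> i) \<omega>\<bar>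
            < 2 * (3 * b) + (gM\<^sup>2 + 2 * \<sigma> * R * G) * (\<tau> (Suc i) - \<tau> i)"
          using i(1) \<tau>(1)[of i] \<tau>(1)[of "Suc i"] \<tau>_mono[of i "Suc i"]
          by (intro increment_escape less) auto
        moreover have "\<sigma> * gm * (z * sqrt b) \<le> \<sigma> * gm * \<bar>B (\<tau> (Suc i)) \<omega> - B (\<tau> i) \<omega>\<bar>"
          using i(2) \<sigma> gm_pos by (intro mult_left_mono) auto
        ultimately show False using jump unfolding d by linarith
      qed
      then obtain j where j: "j \<le> n" "3 * b \<le> \<bar>\<mu> (\<tau> j) \<omega>\<bar>" by blast
      define i where "i = (LEAST j. 3 * b \<le> \<bar>\<mu> (\<tau> j) \<omega>\<bar>)"
      have i: "3 * b \<le> \<bar>\<mu> (\<tau> i) \<omega>\<bar>" "i \<le> n"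
        unfolding i_def using j by (auto intro: LeastI Least_le order_trans)
      \<comment> \<open>Minimality of the exit index puts the sample point in \<open>D i\<close>, so
        that avoiding \<open>E4\<close> means avoiding \<open>A i\<close>.\<close>
      have "\<omega> \<in> D i"
        using \<omega> i not_less_Least[of _ "\<lambda>j. 3 * b \<le> \<bar>\<mu> (\<tau> j) \<omega>\<bar>"] unfolding D_def i_def[symmetric]
        by (auto simp: not_le)
      then have "\<omega> \<notin> A i" using nE(4) i(2) by (auto simp: E4_def)
      then have inc: "\<bar>B t \<omega> - B (\<tau> i) \<omega>\<bar> \<le> \<beta> / l + l / 2 * (t - \<tau> i)" if "t \<in> {\<tau> i..T}" for t
        using \<omega> that by (auto simp: A_def not_less)
      have le: "gM\<^sup>2 * \<tau> i \<le> gM\<^sup>2 * (real n * b)"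
        using \<tau>(3)[OF i(2)] by (intro mult_left_mono) auto
      have "\<exists>s\<in>{1, - 1}. \<forall>t\<in>{0..T}. \<bar>\<mu> t \<omega> - s * k t\<bar> \<le> 2 * gM\<^sup>2 * \<tau> i + 2 * \<nu> + 2 * \<epsilon> * k T"
        using drift \<tau>(1,2)[OF i(2)] b i(1) inc const small le
        by (intro close_to_extremal[where a = a and b = b and c = "\<beta> / l" and l = l]) (auto simp: \<nu>_def)
      then show "\<exists>s\<in>{1, - 1}. \<forall>t\<in>{0..T}. \<bar>\<mu> t \<omega> - s * k t\<bar>
        \<le> 2 * gM\<^sup>2 * (real n * b) + 2 * (2 * \<sigma> * R * (gM + G * T)) + 2 * \<epsilon> * k T"
        using le unfolding \<nu>_def by fastforce
    qed
  qed
  then show ?thesis using EM PE unfolding E2_def by blast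
qed

end

section \<open>Passage to the limit\<close>

text \<open>By symmetry twice the expectation is that of \<open>\<Phi>\<close> summed over the path
  and its reflection. Off \<open>E\<close> this sum is within \<open>2 * e\<close> of the sum over
  \<open>h\<close> and its reflection, and on \<open>E\<close> the four values differ by at most
  \<open>4 * C\<close>; halving gives the claim.\<close>

lemma expectation_near_symmetric_pair:
  assumes T: "0 < T" and M: "prob_space M"
    and X: "\<And>t. t \<in> {0..T} \<Longrightarrow> X t \<in> borel_measurable M" "continuous_process T M X"
    and law: "distr M (Pi\<^sub>M {0..T} (\<lambda>_. borel)) (\<lambda>\<omega>. restrict (\<lambda>t. X t \<omega>) {0..T})
      = distr M (Pi\<^sub>M {0..T} (\<lambda>_. borel)) (\<lambda>\<omega>. restrict (\<lambda>t. - X t \<omega>) {0..T})"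
    and \<Phi>: "bcont_functional T \<Phi>" "\<And>f. continuous_on {0..T} f \<Longrightarrow> \<bar>\<Phi> f\<bar> \<le> C"
    and h: "continuous_on {0..T} h" and e: "0 \<le> e"
    and near: "\<And>f. continuous_on {0..T} f \<Longrightarrow> sup_dist T h f \<le> \<rho> \<Longrightarrow> \<bar>\<Phi> f - \<Phi> h\<bar> \<le> e"
      "\<And>f. continuous_on {0..T} f \<Longrightarrow> sup_dist T (\<lambda>t. - h t) f \<le> \<rho> \<Longrightarrow> \<bar>\<Phi> f - \<Phi> (\<lambda>t. - h t)\<bar> \<le> e"
    and E: "E \<in> sets M"
      "AE \<omega> in M. \<omega> \<notin> E \<longrightarrow> (\<exists>s\<in>{1, - 1}. \<forall>t\<in>{0..T}. \<bar>X t \<omega> - s * h t\<bar> \<le> \<rho>)"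
  shows "\<bar>(\<integral>\<omega>. \<Phi> (\<lambda>t. X t \<omega>) \<partial>M) - (1 / 2 * \<Phi> h + 1 / 2 * \<Phi> (\<lambda>t. - h t))\<bar> \<le> e + 2 * C * measure M E"
proof -
  interpret prob_space M by (rule M)
  define c where "c = \<Phi> h + \<Phi> (\<lambda>t. - h t)"
  have nX: "continuous_process T M (\<lambda>t \<omega>. - X t \<omega>)" "\<And>t. t \<in> {0..T} \<Longrightarrow> (\<lambda>\<omega>. - X t \<omega>) \<in> borel_measurable M"
    using X unfolding continuous_process_def by (auto intro: continuous_on_minus)
  have int: "integrable M (\<lambda>\<omega>. \<Phi> (\<lambda>t. X t \<omega>))" "integrable M (\<lambda>\<omega>. \<Phi> (\<lambda>t. - X t \<omega>))"
    using integrable_bcont_functional[OF T M _ X(2) \<Phi>(1)] integrable_bcont_functional[OF T M _ nX(1) \<Phi>(1)] X(1) nX(2)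
    by blast+
  have eq: "(\<integral>\<omega>. \<Phi> (\<lambda>t. X t \<omega>) \<partial>M) = (\<integral>\<omega>. \<Phi> (\<lambda>t. - X t \<omega>) \<partial>M)"
    by (rule integral_bcont_functional_eq[OF T M _ X(2) _ nX(1) law \<Phi>(1)]) (use X(1) nX(2) in blast)+
  have "0 \<le> C" using \<Phi>(2)[OF h] abs_ge_zero[of "\<Phi> h"] by linarith
  have cont: "continuous_on {0..T} (\<lambda>t. X t \<omega>)" "continuous_on {0..T} (\<lambda>t. - X t \<omega>)" if "\<omega> \<in> space M" for \<omega>
    using X(2) nX(1) that unfolding continuous_process_def by blast+
  have nh: "continuous_on {0..T} (\<lambda>t. - h t)" using h by (rule continuous_on_minus)
  have bound: "AE \<omega> in M. \<bar>\<Phi> (\<lambda>t. X t \<omega>) + \<Phi> (\<lambda>t. - X t \<omega>) - c\<bar> \<le> 2 * e + 4 * C * indicator E \<omega>"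
    using E(2) AE_space
  proof eventually_elim
    case (elim \<omega>)
    note c\<omega> = cont[OF elim(2)]
    show ?case
    proof (cases "\<omega> \<in> E")
      case True
      then show ?thesis
        using \<Phi>(2)[OF c\<omega>(1)] \<Phi>(2)[OF c\<omega>(2)] \<Phi>(2)[OF h] \<Phi>(2)[OF nh] e by (simp add: c_def)
    next
      case False
      then obtain s where s: "s \<in> {1, - 1}" "\<And>t. t \<in> {0..T} \<Longrightarrow> \<bar>X t \<omega> - s * h t\<bar> \<le> \<rho>"
        using elim by blast
      \<comment> \<open>The sign only decides which of the path and its reflection is close to
        \<open>h\<close>; the sum does not see it.\<close>
      consider "s = 1" | "s = - 1" using s(1) by blast
      then have "\<bar>\<Phi> (\<lambda>t. X t \<omega>) + \<Phi> (\<lambda>t. - X t \<omega>) - c\<bar> \<le> 2 * e"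
      proof cases
        case 1
        have "sup_dist T h (\<lambda>t. X t \<omega>) \<le> \<rho>" "sup_dist T (\<lambda>t. - h t) (\<lambda>t. - X t \<omega>) \<le> \<rho>"
          using s(2) T unfolding 1 by (intro sup_dist_le; force simp: abs_minus_commute)+
        then show ?thesis using near(1)[OF c\<omega>(1)] near(2)[OF c\<omega>(2)] unfolding c_def by linarith
      next
        case 2
        have "\<bar>h t + X t \<omega>\<bar> \<le> \<rho>" if "t \<in> {0..T}" for t
          using s(2)[OF that] unfolding 2 by (simp add: add.commute)
        then have "sup_dist T h (\<lambda>t. - X t \<omega>) \<le> \<rho>" "sup_dist T (\<lambda>t. - h t) (\<lambda>t. X t \<omega>) \<le> \<rho>"
          using T by (intro sup_dist_le; force simp: abs_le_iff)+
        then show ?thesis using near(1)[OF c\<omega>(2)] near(2)[OF c\<omega>(1)] unfolding c_def by linarith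
      qed
      then show ?thesis using False by simp
    qed
  qed
  have iE: "integrable M (indicat_real E)"
    using E(1) by (intro integrable_real_indicator) (simp_all add: less_top[symmetric])
  have "2 * ((\<integral>\<omega>. \<Phi> (\<lambda>t. X t \<omega>) \<partial>M) - c / 2) = (\<integral>\<omega>. \<Phi> (\<lambda>t. X t \<omega>) + \<Phi> (\<lambda>t. - X t \<omega>) - c \<partial>M)"
    using int eq by (simp add: prob_space)
  also have "\<bar>\<dots>\<bar> \<le> (\<integral>\<omega>. \<bar>\<Phi> (\<lambda>t. X t \<omega>) + \<Phi> (\<lambda>t. - X t \<omega>) - c\<bar> \<partial>M)"
    by (rule integral_abs_bound)
  also have "\<dots> \<le> (\<integral>\<omega>. 2 * e + 4 * C * indicator E \<omega> \<partial>M)"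
  proof (rule integral_mono_AE[OF _ _ bound])
    show "integrable M (\<lambda>\<omega>. 2 * e + 4 * C * indicat_real E \<omega>)" using iE by simp
    show "integrable M (\<lambda>\<omega>. \<bar>\<Phi> (\<lambda>t. X t \<omega>) + \<Phi> (\<lambda>t. - X t \<omega>) - c\<bar>)"
      using int by (intro integrable_abs) simp
  qed
  also have "\<dots> = 2 * e + 4 * C * measure M E"
    using E(1) iE by (simp add: prob_space Int_absorb2[OF sets.sets_into_space])
  finally have "\<bar>2 * ((\<integral>\<omega>. \<Phi> (\<lambda>t. X t \<omega>) \<partial>M) - c / 2)\<bar> \<le> 2 * e + 4 * C * measure M E" .
  moreover have "\<bar>x\<bar> \<le> e + 2 * y" if "\<bar>2 * x\<bar> \<le> 2 * e + 4 * y" for x y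
    using that by linarith
  moreover have "1 / 2 * \<Phi> h + 1 / 2 * \<Phi> (\<lambda>t. - h t) = c / 2" by (simp add: c_def)
  ultimately show ?thesis by (simp only: mult.assoc)
qed

section \<open>Consequences of the slow growth of \<open>L\<close>\<close>

text \<open>Eventually \<open>L \<sigma>\<close> is at most
  \<open>(- ln \<sigma>) powr (1/8)\<close>. So \<open>L\<close> is beaten by any positive power of
  \<open>\<sigma>\<close>, and the chance of a large increment, of order at least
  \<open>exp (- K\<^sup>2 * (- ln \<sigma>) powr (1/8))\<close>, decays more slowly than any power:
  about \<open>1 / \<sigma>\<close> trials almost surely succeed in the limit.\<close>

lemma slow_growth_limits:
  fixes L :: "real \<Rightarrow> real"
  assumes pos: "\<forall>\<sigma>>0. L \<sigma> > 0"
    and slow: "((\<lambda>\<sigma>. L \<sigma> * \<bar>ln \<sigma>\<bar> powr (-1/8)) \<longlongrightarrow> 0) (at_right 0)"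
  shows "((\<lambda>\<sigma>. \<sigma> * L \<sigma>) \<longlongrightarrow> 0) (at_right 0)"
    and "0 < K \<Longrightarrow> ((\<lambda>\<sigma>. (1 - exp (- (K * sqrt (L \<sigma>) + 1)\<^sup>2 / 2) / sqrt (2 * pi)) ^ nat \<lfloor>1 / \<sigma>\<rfloor>) \<longlongrightarrow> 0) (at_right 0)"
proof -
  have ev01: "\<forall>\<^sub>F \<sigma> in at_right 0. \<sigma> \<in> {0<..<1::real}"
    by (rule eventually_at_right_real) simp
  have L_le: "\<forall>\<^sub>F \<sigma> in at_right 0. L \<sigma> \<le> (- ln \<sigma>) powr (1/8)"
    using order_tendstoD(2)[OF slow zero_less_one] ev01
  proof eventually_elim
    case (elim \<sigma>)
    then have ln: "0 < - ln \<sigma>" "\<bar>ln \<sigma>\<bar> = - ln \<sigma>" by (auto simp: ln_less_zero_iff)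
    have "L \<sigma> = (L \<sigma> * \<bar>ln \<sigma>\<bar> powr (-1/8)) * (- ln \<sigma>) powr (1/8)"
      unfolding ln(2) using ln(1) by (simp flip: powr_add)
    also have "\<dots> \<le> 1 * (- ln \<sigma>) powr (1/8)"
      using elim by (intro mult_right_mono) auto
    finally show ?case by simp
  qed
  show "((\<lambda>\<sigma>. \<sigma> * L \<sigma>) \<longlongrightarrow> 0) (at_right 0)"
  proof (rule tendsto_sandwich)
    show "\<forall>\<^sub>F \<sigma> in at_right 0. 0 \<le> \<sigma> * L \<sigma>"
      using ev01 by eventually_elim (use pos in \<open>auto intro: less_imp_le\<close>)
    show "\<forall>\<^sub>F \<sigma> in at_right 0. \<sigma> * L \<sigma> \<le> \<sigma> * (- ln \<sigma>) powr (1/8)"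
      using ev01 L_le by eventually_elim (auto intro: mult_left_mono)
    show "((\<lambda>\<sigma>::real. \<sigma> * (- ln \<sigma>) powr (1/8)) \<longlongrightarrow> 0) (at_right 0)" by real_asymp
  qed simp
  assume K: "0 < K"
  show "((\<lambda>\<sigma>. (1 - exp (- (K * sqrt (L \<sigma>) + 1)\<^sup>2 / 2) / sqrt (2 * pi)) ^ nat \<lfloor>1 / \<sigma>\<rfloor>) \<longlongrightarrow> 0) (at_right 0)"
  proof (rule tendsto_sandwich)
    let ?p = "\<lambda>\<sigma>. exp (- (K * sqrt (L \<sigma>) + 1)\<^sup>2 / 2) / sqrt (2 * pi)"
    let ?q = "\<lambda>\<sigma>. exp (- (K\<^sup>2 * (- ln \<sigma>) powr (1/8) + 1)) / sqrt (2 * pi)"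
    have p1: "?p \<sigma> \<le> 1" for \<sigma>
    proof -
      have "1 \<le> sqrt (2 * pi)" using pi_gt3 by simp
      moreover have "exp (- (K * sqrt (L \<sigma>) + 1)\<^sup>2 / 2) \<le> 1" by simp
      ultimately have "exp (- (K * sqrt (L \<sigma>) + 1)\<^sup>2 / 2) \<le> sqrt (2 * pi)" by linarith
      then show ?thesis by simp
    qed
    then show "\<forall>\<^sub>F \<sigma> in at_right 0. 0 \<le> (1 - ?p \<sigma>) ^ nat \<lfloor>1 / \<sigma>\<rfloor>"
      by (intro always_eventually allI zero_le_power) simp
    show "\<forall>\<^sub>F \<sigma> in at_right 0. (1 - ?p \<sigma>) ^ nat \<lfloor>1 / \<sigma>\<rfloor> \<le> exp (- (?q \<sigma> * (1 / \<sigma> - 1)))"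
      using ev01 L_le
    proof eventually_elim
      case (elim \<sigma>)
      \<comment> \<open>Rounding down loses at most one trial.\<close>
      have n: "1 / \<sigma> - 1 \<le> real (nat \<lfloor>1 / \<sigma>\<rfloor>)" "0 \<le> 1 / \<sigma> - 1"
        using elim by (linarith, simp)
      have "(1 - ?p \<sigma>) ^ nat \<lfloor>1 / \<sigma>\<rfloor> \<le> exp (- ?p \<sigma>) ^ nat \<lfloor>1 / \<sigma>\<rfloor>"
        using exp_ge_add_one_self[of "- ?p \<sigma>"] p1[of \<sigma>] by (intro power_mono) auto
      also have "\<dots> = exp (- (?p \<sigma> * real (nat \<lfloor>1 / \<sigma>\<rfloor>)))"
        by (simp add: mult.commute flip: exp_of_nat_mult)
      also have "\<dots> \<le> exp (- (?q \<sigma> * (1 / \<sigma> - 1)))"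
      proof -
        have L: "0 \<le> L \<sigma>" using pos elim by (auto intro: less_imp_le)
        \<comment> \<open>The elementary bound
          \<open>(x + 1)\<^sup>2 / 2 \<le> x\<^sup>2 + 1\<close> removes the mixed term with the
          square root.\<close>
        have "(K * sqrt (L \<sigma>) + 1)\<^sup>2 / 2 \<le> (K * sqrt (L \<sigma>))\<^sup>2 + 1"
          using zero_le_power2[of "K * sqrt (L \<sigma>) - 1"] by (simp add: power2_eq_square algebra_simps)
        also have "\<dots> = K\<^sup>2 * L \<sigma> + 1" using L by (simp add: power_mult_distrib)
        also have "\<dots> \<le> K\<^sup>2 * (- ln \<sigma>) powr (1/8) + 1"
          using elim by (intro add_right_mono mult_left_mono) auto
        finally have "?q \<sigma> \<le> ?p \<sigma>" by (intro divide_right_mono) auto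
        then have "?q \<sigma> * (1 / \<sigma> - 1) \<le> ?p \<sigma> * real (nat \<lfloor>1 / \<sigma>\<rfloor>)"
          using n by (intro mult_mono) auto
        then show ?thesis by simp
      qed
      finally show ?case .
    qed
    show "((\<lambda>\<sigma>. exp (- (?q \<sigma> * (1 / \<sigma> - 1)))) \<longlongrightarrow> 0) (at_right 0)"
      using K by real_asymp
  qed simp
qed

section \<open>Choice of the constants and conclusion\<close>

theorem mainTheorem9:
  fixes T \<kappa> \<delta> :: real
    and \<eta> :: "real \<Rightarrow> real"
    and \<theta>t :: "real \<Rightarrow> real \<Rightarrow> real \<Rightarrow> real"
    and L :: "real \<Rightarrow> real"
    and M :: "real \<Rightarrow> 'a measure"
    and F :: "real \<Rightarrow> real \<Rightarrow> 'a measure"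
    and B \<mu> Y \<Delta> :: "real \<Rightarrow> real \<Rightarrow> 'a \<Rightarrow> real"
  assumes T_pos: "0 < T"
    and delta: "0 < \<delta>" "\<delta> < T"
    and eta_ode: "\<forall>t\<in>{0..T}. (\<eta> has_real_derivative ((\<eta> t)\<^sup>2 - 2 * \<kappa> * \<eta> t - 1)) (at t within {0..T})"
    and eta_T: "\<eta> T = 1"
    and theta_tilde: "\<forall>\<sigma>\<in>{0<..<1}. continuous_on ({0..T} \<times> UNIV) (\<lambda>(t, x). \<theta>t \<sigma> t x)
                        \<and> (\<forall>t\<in>{0..T}. \<forall>x. \<theta>t \<sigma> t x \<in> {-1..1})"
    (* (A1) *)
    and A1_L_pos: "\<forall>\<sigma>>0. L \<sigma> > 0"
    and A1_L_inf: "filterlim L at_top (at_right 0)"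
    and A1_L_slow: "((\<lambda>\<sigma>. L \<sigma> * \<bar>ln \<sigma>\<bar> powr (-1/8)) \<longlongrightarrow> 0) (at_right 0)"
    and A1_conv: "\<forall>\<psi>. admissible T \<kappa> \<eta> \<delta> \<psi> \<longrightarrow>
        ((\<lambda>\<sigma>. SUP p \<in> {(t, x). t \<in> {0..T} \<and> \<bar>x\<bar> \<ge> \<sigma>\<^sup>2 * L \<sigma> + \<psi> t}.
             \<bar>\<theta>t \<sigma> (fst p) (snd p) - theta T \<kappa> \<eta> \<delta> (fst p) (snd p)\<bar>) \<longlongrightarrow> 0) (at_right 0)"
    (* (A2) *)
    and A2_bm: "\<forall>\<sigma>\<in>{0<..<1}. brownian_motion T (M \<sigma>) (F \<sigma>) (B \<sigma>)"
    and A2_proc: "\<forall>\<sigma>\<in>{0<..<1}.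
        adapted_on T (F \<sigma>) (\<mu> \<sigma>) \<and> adapted_on T (F \<sigma>) (Y \<sigma>) \<and> adapted_on T (F \<sigma>) (\<Delta> \<sigma>) \<and>
        continuous_process T (M \<sigma>) (\<mu> \<sigma>) \<and> continuous_process T (M \<sigma>) (Y \<sigma>) \<and>
        continuous_process T (M \<sigma>) (\<Delta> \<sigma>) \<and>
        (\<forall>\<omega>\<in>space (M \<sigma>). \<forall>t\<in>{0..T}. Y \<sigma> t \<omega> \<in> {-1..1})"
    and A2_eq: "\<forall>\<sigma>\<in>{0<..<1}. AE \<omega> in M \<sigma>. \<forall>t\<in>{0..T}.
        \<mu> \<sigma> t \<omega> = - integral {0..t} (\<lambda>s. Y \<sigma> s \<omega> / (wfun T \<kappa> \<eta> s)\<^sup>2)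
                    + \<sigma> * wiener_int (\<lambda>s. 1 / wfun T \<kappa> \<eta> s) (B \<sigma>) t \<omega>
        \<and> Y \<sigma> t \<omega> = \<theta>t \<sigma> t (\<mu> \<sigma> t \<omega>) - \<Delta> \<sigma> t \<omega>"
    and A2_Delta: "\<forall>\<epsilon>>0. ((\<lambda>\<sigma>. measure (M \<sigma>)
        {\<omega>\<in>space (M \<sigma>). (SUP t\<in>{0..T}. \<bar>\<Delta> \<sigma> t \<omega>\<bar>) > \<epsilon>}) \<longlongrightarrow> 0) (at_right 0)"
    (* (A3) *)
    and A3: "\<forall>\<sigma>\<in>{0<..<1}.
        distr (M \<sigma>) (Pi\<^sub>M {0..T} (\<lambda>_. borel)) (\<lambda>\<omega>. restrict (\<lambda>t. \<mu> \<sigma> t \<omega>) {0..T})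
      = distr (M \<sigma>) (Pi\<^sub>M {0..T} (\<lambda>_. borel)) (\<lambda>\<omega>. restrict (\<lambda>t. - \<mu> \<sigma> t \<omega>) {0..T})"
  shows "\<forall>\<Phi>. bcont_functional T \<Phi> \<longrightarrow>
     ((\<lambda>\<sigma>. \<integral>\<omega>. \<Phi> (\<lambda>t. \<mu> \<sigma> t \<omega>) \<partial>M \<sigma>) \<longlongrightarrow>
        (1/2) * \<Phi> (kfun T \<kappa> \<eta>) + (1/2) * \<Phi> (\<lambda>t. - kfun T \<kappa> \<eta> t)) (at_right 0)"
proof (intro allI impI)
  fix \<Phi> assume \<Phi>: "bcont_functional T \<Phi>"
  have "continuous_on {0..T} \<eta>"
    using eta_ode by (intro DERIV_continuous_on) blast
  then interpret coefficients T \<kappa> \<eta> using T_pos by unfold_locales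
  obtain gm gM G where bounds: "0 < gm" "0 < gM" "0 < G"
    "\<And>t. t \<in> {0..T} \<Longrightarrow> gm \<le> g t" "\<And>t. t \<in> {0..T} \<Longrightarrow> g t \<le> gM" "\<And>t. t \<in> {0..T} \<Longrightarrow> \<bar>g' t\<bar> \<le> G"
    by (rule coefficient_bounds) blast
  interpret bounded_coefficients T \<kappa> \<eta> gm gM G
    using bounds by unfold_locales
  obtain C where C: "\<And>f. continuous_on {0..T} f \<Longrightarrow> \<bar>\<Phi> f\<bar> \<le> C"
    using \<Phi> by (auto simp: bcont_functional_def)
  have C0: "0 \<le> C" using C[OF continuous_k] abs_ge_zero[of "\<Phi> k"] by linarith
  have kT: "0 \<le> k T" using k_nonneg[of T] T_pos by simp
  have k_less: "k s < k t" if "0 \<le> s" "s < t" "t \<le> T" for s t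
  proof -
    have "0 < gm\<^sup>2 * (t - s)" using that gm_pos by simp
    with k_diff_bounds(1)[of s t] that show ?thesis by linarith
  qed
  \<comment> \<open>The barrier starts to rise at a time strictly between 0 and
    \<open>\<delta>\<close>: being below \<open>\<delta>\<close> makes \<open>\<psi>\<close>
    strictly larger than the threshold of \<open>theta\<close>, and being positive gives the path
    its head start.\<close>
  define a where "a = \<delta> / 2"
  have a: "0 < a" "a < \<delta>" "a \<le> T" using delta by (auto simp: a_def)
  define \<psi> where "\<psi> t = max 0 (k t - k a)" for t
  have adm: "admissible T \<kappa> \<eta> \<delta> \<psi>"
    unfolding admissible_def
  proof (intro conjI ballI impI exI[of _ a])
    show "continuous_on {0..T} \<psi>" unfolding \<psi>_def by (intro continuous_intros continuous_k)
    show "\<psi> s \<le> \<psi> t" if "s \<in> {0..T}" "t \<in> {0..T}" "s \<le> t" for s t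
      using k_mono[of s t] that unfolding \<psi>_def by auto
    fix t assume t: "t \<in> {0..T}" "a < t"
    have "rfun T \<kappa> \<eta> \<delta> - rfun T \<kappa> \<eta> t = k t - k \<delta>" using t delta by (intro r_diff) auto
    then show "max 0 (rfun T \<kappa> \<eta> \<delta> - rfun T \<kappa> \<eta> t) < \<psi> t"
      using k_less[of a t] k_less[of a \<delta>] a t delta unfolding \<psi>_def by auto
  qed (use a in \<open>auto simp: \<psi>_def\<close>)
  have theta_eq: "theta T \<kappa> \<eta> \<delta> t x = - sgn x" if t: "t \<in> {0..T}" and c: "0 < c" "c + \<psi> t \<le> \<bar>x\<bar>" for t x c
  proof -
    have "rfun T \<kappa> \<eta> \<delta> - rfun T \<kappa> \<eta> t = k t - k \<delta>" using t delta by (intro r_diff) auto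
    then show ?thesis
      using k_mono[of a \<delta>] c a delta unfolding theta_def \<psi>_def by auto
  qed
  have theta_le: "\<bar>theta T \<kappa> \<eta> \<delta> t x\<bar> \<le> 1" for t x
    unfolding theta_def by (auto simp: sgn_if abs_divide divide_le_eq_1)
  have ev01: "\<forall>\<^sub>F \<sigma> in at_right 0. \<sigma> \<in> {0<..<1::real}"
    by (rule eventually_at_right_real) simp

  show "((\<lambda>\<sigma>. \<integral>\<omega>. \<Phi> (\<lambda>t. \<mu> \<sigma> t \<omega>) \<partial>M \<sigma>) \<longlongrightarrow> (1/2) * \<Phi> k + (1/2) * \<Phi> (\<lambda>t. - k t)) (at_right 0)"
  proof (rule tendstoI)
    fix e :: real assume e: "0 < e"
    have nk: "continuous_on {0..T} (\<lambda>t. - k t)" by (intro continuous_intros continuous_k)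
    have modulus: "\<exists>d>0. \<forall>g. continuous_on {0..T} g \<longrightarrow> sup_dist T f g < d \<longrightarrow> \<bar>\<Phi> g - \<Phi> f\<bar> < e / 4"
      if "continuous_on {0..T} f" for f
    proof -
      have "0 < e / 4" using e by simp
      with \<Phi> that show ?thesis unfolding bcont_functional_def by blast
    qed
    obtain d1 where d1: "0 < d1"
      "\<And>f. continuous_on {0..T} f \<Longrightarrow> sup_dist T k f < d1 \<Longrightarrow> \<bar>\<Phi> f - \<Phi> k\<bar> < e / 4"
      using modulus[OF continuous_k] by blast
    obtain d2 where d2: "0 < d2"
      "\<And>f. continuous_on {0..T} f \<Longrightarrow> sup_dist T (\<lambda>t. - k t) f < d2 \<Longrightarrow> \<bar>\<Phi> f - \<Phi> (\<lambda>t. - k t)\<bar> < e / 4"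
      using modulus[OF nk] by blast
    \<comment> \<open>Halving turns the weak bound by \<open>\<rho>\<close> into the strict bounds
      required by both moduli of continuity.\<close>
    define \<rho> where "\<rho> = min d1 d2 / 2"
    have \<rho>: "0 < \<rho>" "\<rho> < d1" "\<rho> < d2" using d1(1) d2(1) by (auto simp: \<rho>_def)

    \<comment> \<open>Makes the drift error \<open>2 * \<epsilon> * k T\<close> at most half of the
      head start \<open>gm\<^sup>2 * a\<close> and half of the target distance
      \<open>\<rho>\<close>. The added 1 keeps the denominator positive.\<close>
    define \<epsilon> where "\<epsilon> = min (1 / 4) (min (gm\<^sup>2 * a) \<rho> / (4 * (k T + 1)))"
    have \<epsilon>: "0 < \<epsilon>" "2 * \<epsilon> \<le> 1 / 2"
      using kT \<rho> gm_pos a by (auto simp: \<epsilon>_def)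
    have "0 < 4 * (k T + 1)" using kT by simp
    from pos_le_divide_eq[OF this] have "\<epsilon> * (4 * (k T + 1)) \<le> min (gm\<^sup>2 * a) \<rho>"
      unfolding \<epsilon>_def by (metis min.cobounded2)
    moreover have "\<epsilon> * (4 * (k T + 1)) = 2 * (2 * \<epsilon> * k T) + 4 * \<epsilon>" by (simp add: algebra_simps)
    ultimately have \<epsilon>k: "2 * \<epsilon> * k T \<le> gm\<^sup>2 * a / 2" "2 * \<epsilon> * k T \<le> \<rho> / 2"
      using \<epsilon>(1) by linarith+

    \<comment> \<open>\<open>R\<close> tends to infinity while \<open>\<sigma> * R \<sigma>\<close>,
      the size of the noise, tends to 0. With \<open>n \<sigma>\<close> steps of length
      \<open>b \<sigma>\<close> the exit occurs before time
      \<open>\<sigma> * L \<sigma>\<close>.\<close>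
    define R where "R \<sigma> = 1 / sqrt \<sigma>" for \<sigma> :: real
    define n where "n \<sigma> = nat \<lfloor>1 / \<sigma>\<rfloor>" for \<sigma> :: real
    define b where "b \<sigma> = \<sigma>\<^sup>2 * L \<sigma>" for \<sigma>
    \<comment> \<open>With \<open>l = q / \<sigma>\<close> the noise slope condition
      \<open>\<sigma> * gM * l \<le> gm\<^sup>2 / 4\<close> becomes an equality, and the level
      \<open>\<beta> = q * L \<sigma> / gM\<close> makes the offset exactly
      \<open>b \<sigma>\<close>. In \<open>K\<close> the 7 covers the width \<open>6 * b\<close> of
      the band and one more \<open>b\<close> for the remainder of the Wiener integral, and
      \<open>gM\<^sup>2\<close> covers the drift.\<close>
    define q where "q = gm\<^sup>2 / (4 * gM)"
    define K where "K = (7 + gM\<^sup>2) / gm"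
    have q: "0 < q" using gm_pos gM_pos by (simp add: q_def)
    have "0 < 7 + gM\<^sup>2" by (rule add_pos_nonneg) auto
    then have K: "0 < K" using gm_pos by (simp add: K_def)
    define pb where "pb \<sigma> = 2 * exp (T / 2 - R \<sigma>)
      + measure (M \<sigma>) {\<omega>\<in>space (M \<sigma>). (SUP t\<in>{0..T}. \<bar>\<Delta> \<sigma> t \<omega>\<bar>) > \<epsilon>}
      + (1 - exp (- (K * sqrt (L \<sigma>) + 1)\<^sup>2 / 2) / sqrt (2 * pi)) ^ n \<sigma> + 2 * exp (- (q * L \<sigma> / gM))" for \<sigma>
    note L_limits = slow_growth_limits[OF A1_L_pos A1_L_slow]
    have "((\<lambda>\<sigma>. 2 * exp (T / 2 - R \<sigma>)) \<longlongrightarrow> 0) (at_right 0)"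
      unfolding R_def by real_asymp
    moreover have "((\<lambda>\<sigma>. 2 * exp (- (q * L \<sigma> / gM))) \<longlongrightarrow> 0) (at_right 0)"
    proof -
      have "((\<lambda>x. 2 * exp (- (q * x / gM))) \<longlongrightarrow> 0) at_top" using q gM_pos by real_asymp
      from filterlim_compose[OF this A1_L_inf] show ?thesis .
    qed
    ultimately have "(pb \<longlongrightarrow> 0 + 0 + 0 + 0) (at_right 0)"
      unfolding pb_def n_def using A2_Delta \<epsilon>(1) L_limits(2)[OF K] by (intro tendsto_add) auto
    then have "((\<lambda>\<sigma>. 2 * C * pb \<sigma>) \<longlongrightarrow> 2 * C * 0) (at_right 0)" by (intro tendsto_intros) simp
    then have ev_pb: "\<forall>\<^sub>F \<sigma> in at_right 0. 2 * C * pb \<sigma> < e / 2"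
      using e by (intro order_tendstoD) auto
    have R0: "((\<lambda>\<sigma>. 2 * \<sigma> * R \<sigma> * c) \<longlongrightarrow> 0) (at_right 0)" for c
      unfolding R_def by real_asymp
    have ev_R: "\<forall>\<^sub>F \<sigma> in at_right 0. 2 * \<sigma> * R \<sigma> * G < min 1 (gm\<^sup>2 / 8)"
      using gm_pos by (intro order_tendstoD(2)[OF R0]) auto
    \<comment> \<open>The coefficient \<open>1 + 2 * gM\<^sup>2\<close> collects the step length
      \<open>b \<sigma>\<close> and the error accumulated before the exit, both controlled by
      \<open>\<sigma> * L \<sigma>\<close>.\<close>
    have "((\<lambda>\<sigma>. 2 * (2 * \<sigma> * R \<sigma> * (gM + G * T)) + (1 + 2 * gM\<^sup>2) * (\<sigma> * L \<sigma>)) \<longlongrightarrow> 2 * 0 + (1 + 2 * gM\<^sup>2) * 0) (at_right 0)"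
      by (intro tendsto_intros R0 L_limits)
    then have ev_small: "\<forall>\<^sub>F \<sigma> in at_right 0.
        2 * (2 * \<sigma> * R \<sigma> * (gM + G * T)) + (1 + 2 * gM\<^sup>2) * (\<sigma> * L \<sigma>) < min (gm\<^sup>2 * a / 2) (\<rho> / 2)"
      using gm_pos a \<rho> by (intro order_tendstoD(2)) auto
    have ev_a: "\<forall>\<^sub>F \<sigma> in at_right 0. \<sigma> * L \<sigma> < a"
      using a by (intro order_tendstoD(2)[OF L_limits(1)])
    have ev_\<theta>: "\<forall>\<^sub>F \<sigma> in at_right 0. (SUP p \<in> {(t, x). t \<in> {0..T} \<and> \<bar>x\<bar> \<ge> \<sigma>\<^sup>2 * L \<sigma> + \<psi> t}.
             \<bar>\<theta>t \<sigma> (fst p) (snd p) - theta T \<kappa> \<eta> \<delta> (fst p) (snd p)\<bar>) < \<epsilon>"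
      using A1_conv adm \<epsilon>(1) by (intro order_tendstoD(2)) auto
    show "\<forall>\<^sub>F \<sigma> in at_right 0. dist (\<integral>\<omega>. \<Phi> (\<lambda>t. \<mu> \<sigma> t \<omega>) \<partial>M \<sigma>) ((1/2) * \<Phi> k + (1/2) * \<Phi> (\<lambda>t. - k t)) < e"
      using ev01 ev_pb ev_R ev_small ev_a ev_\<theta>
    proof eventually_elim
      case (elim \<sigma>)
      note \<sigma> = elim(1)
      have \<sigma>0: "0 < \<sigma>" "\<sigma> < 1" using \<sigma> by auto
      have L: "0 < L \<sigma>" using A1_L_pos \<sigma> by simp
      have b: "0 < b \<sigma>" "b \<sigma> \<le> \<sigma> * L \<sigma>"
        using \<sigma>0 L mult_right_mono[of "\<sigma> * \<sigma>" "\<sigma>" "L \<sigma>"] by (auto simp: b_def power2_eq_square mult_le_one)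
      have "real (n \<sigma>) \<le> 1 / \<sigma>" using \<sigma>0 by (simp add: n_def)
      then have "real (n \<sigma>) * b \<sigma> \<le> 1 / \<sigma> * b \<sigma>" using b by (intro mult_right_mono) auto
      also have "\<dots> = \<sigma> * L \<sigma>" using \<sigma>0 by (simp add: b_def power2_eq_square)
      finally have nb: "real (n \<sigma>) * b \<sigma> \<le> \<sigma> * L \<sigma>" .
      then have gnb: "gM\<^sup>2 * (real (n \<sigma>) * b \<sigma>) \<le> gM\<^sup>2 * (\<sigma> * L \<sigma>)" by (intro mult_left_mono) auto
      have pos: "0 \<le> 2 * \<sigma> * R \<sigma> * (gM + G * T)" "0 \<le> gM\<^sup>2 * (\<sigma> * L \<sigma>)"
        using \<sigma>0 gM_pos G_pos T_pos L by (auto simp: R_def)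
      have small: "2 * (2 * \<sigma> * R \<sigma> * (gM + G * T)) + \<sigma> * L \<sigma> + 2 * (gM\<^sup>2 * (\<sigma> * L \<sigma>)) < min (gm\<^sup>2 * a / 2) (\<rho> / 2)"
        using elim(4) by (simp add: algebra_simps)
      interpret driven_coefficients T \<kappa> \<eta> gm gM G "M \<sigma>" "F \<sigma>" "B \<sigma>"
        using A2_bm \<sigma> T_pos by unfold_locales auto
      have proc: "adapted_on T (F \<sigma>) (\<mu> \<sigma>)" "adapted_on T (F \<sigma>) (\<Delta> \<sigma>)"
        "continuous_process T (M \<sigma>) (\<mu> \<sigma>)" "continuous_process T (M \<sigma>) (Y \<sigma>)" "continuous_process T (M \<sigma>) (\<Delta> \<sigma>)"
        using A2_proc \<sigma> by blast+
      have \<theta>: "\<bar>\<theta>t \<sigma> t x + sgn x\<bar> \<le> \<epsilon>" if t: "t \<in> {0..T}" and x: "b \<sigma> + max 0 (k t - k a) \<le> \<bar>x\<bar>" for t x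
      proof -
        have "\<bar>\<theta>t \<sigma> t x - theta T \<kappa> \<eta> \<delta> t x\<bar> \<le> (SUP p \<in> {(t, x). t \<in> {0..T} \<and> \<bar>x\<bar> \<ge> \<sigma>\<^sup>2 * L \<sigma> + \<psi> t}.
             \<bar>\<theta>t \<sigma> (fst p) (snd p) - theta T \<kappa> \<eta> \<delta> (fst p) (snd p)\<bar>)"
        \<comment> \<open>A supremum of reals bounds its terms only for bounded families; here both
          feedbacks have absolute value at most 1, so 2 is a bound.\<close>
        proof (rule cSUP_upper2[where x = "(t, x)"])
          show "bdd_above ((\<lambda>p. \<bar>\<theta>t \<sigma> (fst p) (snd p) - theta T \<kappa> \<eta> \<delta> (fst p) (snd p)\<bar>) `
              {(t, x). t \<in> {0..T} \<and> \<bar>x\<bar> \<ge> \<sigma>\<^sup>2 * L \<sigma> + \<psi> t})"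
          proof (rule bdd_aboveI2)
            fix p assume "p \<in> {(t, x). t \<in> {0..T} \<and> \<bar>x\<bar> \<ge> \<sigma>\<^sup>2 * L \<sigma> + \<psi> t}"
            then have "fst p \<in> {0..T}" by auto
            then have "\<bar>\<theta>t \<sigma> (fst p) (snd p)\<bar> \<le> 1" using theta_tilde \<sigma> by (auto simp: abs_le_iff)
            then show "\<bar>\<theta>t \<sigma> (fst p) (snd p) - theta T \<kappa> \<eta> \<delta> (fst p) (snd p)\<bar> \<le> 2"
              using theta_le[of "fst p" "snd p"] by linarith
          qed
        qed (use t x in \<open>auto simp: b_def \<psi>_def\<close>)
        moreover have "theta T \<kappa> \<eta> \<delta> t x = - sgn x"
          using t b(1) x unfolding \<psi>_def[symmetric] by (rule theta_eq)
        ultimately show ?thesis using elim(6) by simp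
      qed
      have "\<exists>E\<in>sets (M \<sigma>).
        (AE \<omega> in M \<sigma>. \<omega> \<notin> E \<longrightarrow> (\<exists>s\<in>{1, - 1}. \<forall>t\<in>{0..T}. \<bar>\<mu> \<sigma> t \<omega> - s * k t\<bar>
          \<le> 2 * gM\<^sup>2 * (real (n \<sigma>) * b \<sigma>) + 2 * (2 * \<sigma> * R \<sigma> * (gM + G * T)) + 2 * \<epsilon> * k T)) \<and>
        measure (M \<sigma>) E \<le> 2 * exp (T / 2 - R \<sigma>)
          + measure (M \<sigma>) {\<omega>\<in>space (M \<sigma>). (SUP t\<in>{0..T}. \<bar>\<Delta> \<sigma> t \<omega>\<bar>) > \<epsilon>}
          + (1 - exp (- (K * sqrt (L \<sigma>) + 1)\<^sup>2 / 2) / sqrt (2 * pi)) ^ n \<sigma> + 2 * exp (- (q * L \<sigma> / gM))"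
      proof (rule exceptional_event[where \<theta> = "\<theta>t \<sigma>" and a = a and l = "q / \<sigma>" and Y = "Y \<sigma>"])
        show "AE \<omega> in M \<sigma>. \<forall>t\<in>{0..T}.
          \<mu> \<sigma> t \<omega> = - integral {0..t} (\<lambda>s. Y \<sigma> s \<omega> / (w s)\<^sup>2) + \<sigma> * wiener_int g (B \<sigma>) t \<omega>
          \<and> Y \<sigma> t \<omega> = \<theta>t \<sigma> t (\<mu> \<sigma> t \<omega>) - \<Delta> \<sigma> t \<omega>"
          using A2_eq \<sigma> by blast
        show "\<bar>Y \<sigma> t \<omega>\<bar> \<le> 1" if "\<omega> \<in> space (M \<sigma>)" "t \<in> {0..T}" for \<omega> t
          using A2_proc \<sigma> that by (auto simp: abs_le_iff)
        show "real (n \<sigma>) * b \<sigma> \<le> a" using nb elim(5) by simp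
        show "6 * b \<sigma> + (gM\<^sup>2 + 2 * \<sigma> * R \<sigma> * G) * b \<sigma> \<le> \<sigma> * gm * (K * sqrt (L \<sigma>) * sqrt (b \<sigma>))"
        proof -
          have "sqrt (b \<sigma>) = \<sigma> * sqrt (L \<sigma>)" using \<sigma>0 by (simp add: b_def real_sqrt_mult)
          then have "\<sigma> * gm * (K * sqrt (L \<sigma>) * sqrt (b \<sigma>)) = gm * K * (\<sigma> * \<sigma> * (sqrt (L \<sigma>) * sqrt (L \<sigma>)))"
            by simp
          also have "\<dots> = (7 + gM\<^sup>2) * b \<sigma>"
            using L gm_pos by (simp add: K_def b_def power2_eq_square)
          finally show ?thesis
            using elim(3) b(1) mult_right_mono[of "2 * \<sigma> * R \<sigma> * G" 1 "b \<sigma>"] by (simp add: distrib_right)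
        qed
        show "\<sigma> * gM * (q * L \<sigma> / gM / (q / \<sigma>)) \<le> b \<sigma>"
          using \<sigma>0 gM_pos q by (simp add: b_def power2_eq_square)
        show "\<sigma> * gM * (q / \<sigma>) \<le> gm\<^sup>2 / 4"
          using \<sigma>0 gM_pos by (simp add: q_def)
        show "2 * \<sigma> * R \<sigma> * G \<le> gm\<^sup>2 / 8" using elim(3) by simp
        show "2 * \<epsilon> * k T + 2 * \<sigma> * R \<sigma> * (gM + G * T) + b \<sigma> + gM\<^sup>2 * (real (n \<sigma>) * b \<sigma>) < gm\<^sup>2 * a"
          using \<epsilon>k(1) small b(2) gnb pos by linarith
      qed (use \<sigma>0 proc \<theta> b a K L q \<epsilon> in auto)
      then obtain E where E: "E \<in> sets (M \<sigma>)" "measure (M \<sigma>) E \<le> pb \<sigma>"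
        "AE \<omega> in M \<sigma>. \<omega> \<notin> E \<longrightarrow> (\<exists>s\<in>{1, - 1}. \<forall>t\<in>{0..T}. \<bar>\<mu> \<sigma> t \<omega> - s * k t\<bar>
          \<le> 2 * gM\<^sup>2 * (real (n \<sigma>) * b \<sigma>) + 2 * (2 * \<sigma> * R \<sigma> * (gM + G * T)) + 2 * \<epsilon> * k T)"
        unfolding pb_def by blast
      have "2 * gM\<^sup>2 * (real (n \<sigma>) * b \<sigma>) + 2 * (2 * \<sigma> * R \<sigma> * (gM + G * T)) + 2 * \<epsilon> * k T \<le> \<rho>"
        using \<epsilon>k(2) small gnb b pos by linarith
      then have "AE \<omega> in M \<sigma>. \<omega> \<notin> E \<longrightarrow> (\<exists>s\<in>{1, - 1}. \<forall>t\<in>{0..T}. \<bar>\<mu> \<sigma> t \<omega> - s * k t\<bar> \<le> \<rho>)"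
        using E(3) by (elim eventually_mono) (meson order_trans)
      then have "\<bar>(\<integral>\<omega>. \<Phi> (\<lambda>t. \<mu> \<sigma> t \<omega>) \<partial>M \<sigma>) - (1 / 2 * \<Phi> k + 1 / 2 * \<Phi> (\<lambda>t. - k t))\<bar>
          \<le> e / 4 + 2 * C * measure (M \<sigma>) E"
        using T_pos prob_space_axioms adapted_M[OF proc(1)] proc(3) A3 \<sigma> \<Phi> C continuous_k e E(1) d1(2) d2(2) \<rho>
        by (intro expectation_near_symmetric_pair[where \<rho> = \<rho>]) (auto intro: less_imp_le)
      also have "\<dots> \<le> e / 4 + 2 * C * pb \<sigma>"
        using E(2) C0 by (intro add_left_mono mult_left_mono) auto
      also have "\<dots> < e" using elim(2) e by linarith
      finally show ?case by (simp add: dist_real_def)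
    qed
  qed
qed

end
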